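(* Let $\kappa$ be a strongly inaccessible cardinal and $S\subseteq\mathrm{acc}(\kappa)$. If $\mathrm P(\kappa,\kappa,\sqsubseteq^S,1,\{S\})$ holds, then there exists a normal, prolific, streamlined $\kappa$-Souslin tree $T$ such that $V^-(T)=V(T)=S$.
   Context: $\mathrm{acc}(\kappa)$: nonzero limit ordinals $<\kappa$. $H_\kappa$: sets of hereditary cardinality $<\kappa$. A streamlined $\kappa$-tree is a set $T\subseteq{}^{<\kappa}H_\kappa$ closed under restrictions with each $T_\alpha=T\cap{}^\alpha H_\kappa$ ($\alpha<\kappa$) nonempty of size $<\kappa$, viewed as the tree $(T,\subsetneq)$. Normal: for $\alpha<\beta<\kappa$, each node of level $\alpha$ has an extension in level $\beta$. Prolific: for all $\alpha<\kappa$ and $t\in T_\alpha$, $t^\frown\langle i\rangle\in T$ for every $i<\max\{\omega,\alpha\}$. $\kappa$-Souslin: no $\kappa$-branch and no antichain of size $\kappa$. An $\alpha$-branch: linearly ordered subset with set of heights $\alpha$; vanishing if no upper bound. $V^-(T)$: set of $\alpha\in\mathrm{acc}(\kappa)$ admitting a vanishing $\alpha$-branch; $V(T)$: set of $\alpha\in\mathrm{acc}(\kappa)$ such that every node of height $<\alpha$ lies on a vanishing $\alpha$-branch. For a set of ordinals $C$: $\mathrm{acc}(C)=\{\alpha\in C\mid\sup(C\cap\alpha)=\alpha>0\}$, $\mathrm{nacc}(C)=C\setminus\mathrm{acc}(C)$. $D\sqsubseteq^S C$ iff $D=C\cap\beta$ for some ordinal $\beta$ and $\sup(D)\notin S$.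 $\mathrm P(\kappa,\kappa,\sqsubseteq^S,1,\{S\})$ asserts that $\diamondsuit(\kappa)$ holds and there is a sequence $\langle\mathcal C_\alpha\mid\alpha<\kappa\rangle$ where each $\mathcal C_\alpha$ is a nonempty family of fewer than $\kappa$ closed subsets $C$ of $\alpha$ with $\sup(C)=\sup(\alpha)$, such that for all $\alpha<\kappa$, $C\in\mathcal C_\alpha$, $\bar\alpha\in\mathrm{acc}(C)$ there is $D\in\mathcal C_{\bar\alpha}$ with $D\sqsubseteq^S C$, and for every cofinal $B\subseteq\kappa$ there are stationarily many $\alpha\in S$ with $\sup(\mathrm{nacc}(C)\cap B)=\alpha$ for all $C\in\mathcal C_\alpha$. *)

theory Defs
  imports Main
begin

unbundle cardinal_syntax

text \<open>
  A cardinal \<open>\<kappa>\<close> is represented by a type \<open>'k\<close> of class \<open>wellorder\<close> whose order type is \<open>\<kappa>\<close>: the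
  elements of \<open>'k\<close> are the ordinals below \<open>\<kappa>\<close>, and \<open>\<alpha>\<close> as a set of ordinals is \<open>{..<\<alpha>}\<close>.
\<close>

definition kappa :: "'k::wellorder rel"
  where "kappa = {(\<alpha>, \<beta>). \<alpha> \<le> \<beta>}"

definition strongly_inaccessible :: "'a rel \<Rightarrow> bool"
  where "strongly_inaccessible r \<longleftrightarrow>
    Card_order r \<and> natLeq <o r \<and> regularCard r \<and>
    (\<forall>A \<subseteq> Field r. |A| <o r \<longrightarrow> |Pow A| <o r)"


subsection \<open>Sets of ordinals\<close>

text \<open>Only meant for sets that are bounded below \<open>\<kappa>\<close>; the supremum of the empty set is \<open>0\<close>.\<close>

definition osup :: "'k::wellorder set \<Rightarrow> 'k"
  where "osup A = (LEAST \<beta>. \<forall>\<alpha>\<in>A. \<alpha> \<le> \<beta>)"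

definition ozero :: "'k::wellorder"
  where "ozero = (LEAST \<alpha>. True)"

definition omega :: "'k::wellorder"
  where "omega = (LEAST \<alpha>. infinite {..<\<alpha>})"

text \<open>\<open>acc UNIV\<close> is the set of nonzero limit ordinals below \<open>\<kappa>\<close>.\<close>

definition acc :: "'k::wellorder set \<Rightarrow> 'k set"
  where "acc C = {\<alpha>\<in>C. osup (C \<inter> {..<\<alpha>}) = \<alpha> \<and> \<alpha> > ozero}"

lemma acc_UNIV_iff: "\<alpha> \<in> acc UNIV \<longleftrightarrow> (\<exists>\<beta>. \<beta> < \<alpha>) \<and> (\<forall>\<beta><\<alpha>. \<exists>\<gamma>>\<beta>. \<gamma> < \<alpha>)"
proof -
  have zero: "ozero < \<alpha> \<longleftrightarrow> (\<exists>\<beta>. \<beta> < \<alpha>)"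
    unfolding ozero_def
    by (metis (full_types) LeastI not_less_Least not_less_iff_gr_or_eq order.strict_trans)
  have "osup {..<\<alpha>} = \<alpha> \<longleftrightarrow> (\<forall>\<beta><\<alpha>. \<exists>\<gamma>>\<beta>. \<gamma> < \<alpha>)"
  proof
    assume sup: "osup {..<\<alpha>} = \<alpha>"
    have "\<not> (\<forall>\<gamma>\<in>{..<\<alpha>}. \<gamma> \<le> \<beta>)" if "\<beta> < \<alpha>" for \<beta>
      using that sup not_less_Least[of \<beta> "\<lambda>\<beta>. \<forall>\<gamma>\<in>{..<\<alpha>}. \<gamma> \<le> \<beta>"] unfolding osup_def by auto
    then show "\<forall>\<beta><\<alpha>. \<exists>\<gamma>>\<beta>. \<gamma> < \<alpha>"
      by (force simp: not_le)
  next
    assume *: "\<forall>\<beta><\<alpha>. \<exists>\<gamma>>\<beta>. \<gamma> < \<alpha>"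
    show "osup {..<\<alpha>} = \<alpha>"
      unfolding osup_def by (rule Least_equality) (use * in \<open>auto simp: not_le[symmetric]\<close>)
  qed
  then show ?thesis using zero by (auto simp: acc_def)
qed

definition nacc :: "'k::wellorder set \<Rightarrow> 'k set"
  where "nacc C = C - acc C"

text \<open>\<open>X\<close> is the ambient ordinal, either \<open>{..<\<alpha>}\<close> or \<open>UNIV\<close> (that is, \<open>\<kappa>\<close>).\<close>

definition closed_subset :: "'k::wellorder set \<Rightarrow> 'k set \<Rightarrow> bool"
  where "closed_subset C X \<longleftrightarrow>
    C \<subseteq> X \<and> (\<forall>\<beta>\<in>X. osup (C \<inter> {..<\<beta>}) = \<beta> \<and> \<beta> > ozero \<longrightarrow> \<beta> \<in> C)"

definition club :: "'k::wellorder set \<Rightarrow> bool"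
  where "club C \<longleftrightarrow> closed_subset C UNIV \<and> cofinal C kappa"

definition stationary :: "'k::wellorder set \<Rightarrow> bool"
  where "stationary A \<longleftrightarrow> (\<forall>C. club C \<longrightarrow> A \<inter> C \<noteq> {})"

definition diamond_sequence :: "('k::wellorder \<Rightarrow> 'k set) \<Rightarrow> bool"
  where "diamond_sequence A \<longleftrightarrow>
    (\<forall>\<alpha>. A \<alpha> \<subseteq> {..<\<alpha>}) \<and> (\<forall>Z. stationary {\<alpha>. Z \<inter> {..<\<alpha>} = A \<alpha>})"

text \<open>Meant for sets \<open>C\<close> that are bounded below \<open>\<kappa>\<close>, so that \<open>\<beta> < \<kappa>\<close> is no restriction.\<close>

definition end_extends :: "'k::wellorder set \<Rightarrow> 'k set \<Rightarrow> 'k set \<Rightarrow> bool"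
  (\<open>_ \<sqsubseteq>\<^bsup>_\<^esup> _\<close> [51, 0, 51] 50)
  where "D \<sqsubseteq>\<^bsup>S\<^esup> C \<longleftrightarrow> (\<exists>\<beta>. D = C \<inter> {..<\<beta>}) \<and> osup D \<notin> S"

text \<open>The principle \<open>P(\<kappa>, \<kappa>, \<sqsubseteq>\<^sup>S, 1, {S})\<close>.\<close>

definition proxy_principle :: "'k::wellorder set \<Rightarrow> bool"
  where "proxy_principle S \<longleftrightarrow>
    (\<exists>A :: 'k \<Rightarrow> 'k set. diamond_sequence A) \<and>
    (\<exists>\<C> :: 'k \<Rightarrow> 'k set set.
      (\<forall>\<alpha>. \<C> \<alpha> \<noteq> {} \<and> |\<C> \<alpha>| <o (kappa :: 'k rel) \<and>
        (\<forall>C\<in>\<C> \<alpha>. closed_subset C {..<\<alpha>} \<and> osup C = osup {..<\<alpha>})) \<and>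
      (\<forall>\<alpha>. \<forall>C\<in>\<C> \<alpha>. \<forall>\<alpha>'\<in>acc C. \<exists>D\<in>\<C> \<alpha>'. D \<sqsubseteq>\<^bsup>S\<^esup> C) \<and>
      (\<forall>B. cofinal B kappa \<longrightarrow>
        stationary {\<alpha>\<in>S. \<forall>C\<in>\<C> \<alpha>. osup (nacc C \<inter> B) = \<alpha>}))"


subsection \<open>Sets of hereditary cardinality below \<open>\<kappa>\<close>\<close>

text \<open>
  The type \<open>'k hset\<close> consists of the well-founded sets all of whose hereditary members have at most
  \<open>\<kappa>\<close> elements. They are obtained from well-founded trees in which every vertex has a family of
  children indexed by a subset of \<open>'k\<close>, where a tree stands for the set of the sets its children
  stand for. The lemmas below show that membership is extensional and well-founded, and that the
  sets of members are exactly the subsets of \<open>'k hset\<close> of cardinality at most \<open>\<kappa>\<close>.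
\<close>

datatype 'k code = Code "'k \<rightharpoonup> 'k code"

inductive code_eq :: "'k code \<Rightarrow> 'k code \<Rightarrow> bool"
  where "\<forall>c\<in>ran f. \<exists>d\<in>ran g. code_eq c d \<Longrightarrow> \<forall>d\<in>ran g. \<exists>c\<in>ran f. code_eq c d \<Longrightarrow>
    code_eq (Code f) (Code g)"

lemma code_eq_Code:
  "code_eq (Code f) (Code g) \<longleftrightarrow>
    (\<forall>c\<in>ran f. \<exists>d\<in>ran g. code_eq c d) \<and> (\<forall>d\<in>ran g. \<exists>c\<in>ran f. code_eq c d)"
  by (subst code_eq.simps) auto

lemma code_induct:
  assumes "\<And>f. (\<And>c. c \<in> ran f \<Longrightarrow> P c) \<Longrightarrow> P (Code f)"
  shows "P c"
proof (induction c)
  case (Code f)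
  show ?case
  proof (rule assms)
    fix c assume "c \<in> ran f"
    then obtain i where "f i = Some c" by (auto simp: ran_def)
    then have "Some c \<in> range f" "c \<in> set_option (Some c)" by (metis rangeI) simp
    then show "P c" by (rule Code)
  qed
qed

lemma code_eq_refl: "code_eq c c"
  by (induction c rule: code_induct) (auto simp: code_eq_Code)

lemma code_eq_sym: "code_eq c d \<Longrightarrow> code_eq d c"
  by (induction rule: code_eq.induct) (auto simp: code_eq_Code)

lemma code_eq_trans: "code_eq c d \<Longrightarrow> code_eq d e \<Longrightarrow> code_eq c e"
proof (induction c arbitrary: d e rule: code_induct)
  case (1 f)
  obtain g h where gh: "d = Code g" "e = Code h" by (metis code.exhaust)
  have fg: "\<forall>c\<in>ran f. \<exists>d\<in>ran g. code_eq c d" "\<forall>d\<in>ran g. \<exists>c\<in>ran f. code_eq c d"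
    and gh': "\<forall>c\<in>ran g. \<exists>d\<in>ran h. code_eq c d" "\<forall>d\<in>ran h. \<exists>c\<in>ran g. code_eq c d"
    using "1.prems" by (simp_all add: gh code_eq_Code)
  show ?case
    unfolding gh code_eq_Code using fg gh' "1.IH" by meson
qed

quotient_type 'k hset = "'k code" / code_eq
  by (rule equivpI)
    (auto simp: reflp_def symp_def transp_def code_eq_refl code_eq_sym intro: code_eq_trans)

definition hmem :: "'k hset \<Rightarrow> 'k hset \<Rightarrow> bool"
  where "hmem x y \<longleftrightarrow> (\<exists>f. y = abs_hset (Code f) \<and> x \<in> abs_hset ` ran f)"

definition elts :: "'k hset \<Rightarrow> 'k hset set"
  where "elts y = {x. hmem x y}"

definition hset_of :: "'k hset set \<Rightarrow> 'k hset"
  where "hset_of A = (THE x. elts x = A)"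

lemma abs_hset_eq_iff: "abs_hset c = abs_hset d \<longleftrightarrow> code_eq c d"
  by (rule hset.abs_eq_iff)

lemma elts_Code: "elts (abs_hset (Code f)) = abs_hset ` ran f"
proof -
  have "abs_hset ` ran f \<subseteq> abs_hset ` ran g \<and> abs_hset ` ran g \<subseteq> abs_hset ` ran f"
    if "abs_hset (Code f) = abs_hset (Code g)" for g
    using that unfolding abs_hset_eq_iff code_eq_Code image_subset_iff image_iff
    by (meson code_eq_sym)
  then show ?thesis
    unfolding elts_def hmem_def by blast
qed

lemma hset_cases: obtains f where "x = abs_hset (Code f)"
  by (metis Quotient3_abs_rep[OF Quotient3_hset] code.exhaust)

lemma hset_ext: "elts x = elts y \<Longrightarrow> x = y"
proof -
  assume eq: "elts x = elts y"
  obtain f where f: "x = abs_hset (Code f)" by (rule hset_cases)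
  obtain g where g: "y = abs_hset (Code g)" by (rule hset_cases)
  have im: "abs_hset ` ran f = abs_hset ` ran g"
    using eq by (simp add: f g elts_Code)
  have "\<exists>d\<in>ran g. code_eq c d" if "c \<in> ran f" for c
  proof -
    have "abs_hset c \<in> abs_hset ` ran g" using that im by blast
    then show ?thesis by (auto simp: abs_hset_eq_iff)
  qed
  moreover have "\<exists>c\<in>ran f. code_eq c d" if "d \<in> ran g" for d
  proof -
    have "abs_hset d \<in> abs_hset ` ran f" using that im by blast
    then show ?thesis unfolding image_iff abs_hset_eq_iff using code_eq_sym by blast
  qed
  ultimately show "x = y"
    by (simp add: f g abs_hset_eq_iff code_eq_Code)
qed

lemma wfp_hmem: "wfp (hmem :: 'k hset \<Rightarrow> _)"
proof (rule wfpUNIVI)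
  fix P and x :: "'k hset"
  assume P: "\<forall>x :: 'k hset. (\<forall>y. hmem y x \<longrightarrow> P y) \<longrightarrow> P x"
  have "P (abs_hset c)" for c :: "'k code"
  proof (induction c rule: code_induct)
    case (1 f)
    have "P y" if "hmem y (abs_hset (Code f))" for y
    proof -
      have "y \<in> abs_hset ` ran f" using that by (simp add: elts_Code[symmetric] elts_def)
      then show ?thesis using 1 by blast
    qed
    then show ?case using P by blast
  qed
  moreover obtain f where "x = abs_hset (Code f)" by (rule hset_cases)
  ultimately show "P x" by simp
qed

lemma card_elts: "|elts (x :: 'k hset)| \<le>o |UNIV :: 'k set|"
proof -
  obtain f where x: "x = abs_hset (Code f)" by (rule hset_cases)
  have "elts x \<subseteq> (\<lambda>i. abs_hset (the (f i))) ` UNIV"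
  proof
    fix y assume "y \<in> elts x"
    then obtain i c where "f i = Some c" "y = abs_hset c"
      unfolding x elts_Code by (auto simp: ran_def)
    then have "y = abs_hset (the (f i))" by simp
    then show "y \<in> (\<lambda>i. abs_hset (the (f i))) ` UNIV" by blast
  qed
  then show ?thesis
    by (rule surj_imp_ordLeq)
qed

lemma elts_hset_of:
  fixes A :: "'k hset set"
  assumes "|A| \<le>o |UNIV :: 'k set|"
  shows "elts (hset_of A) = A"
proof -
  obtain e where e: "inj_on e A" "e ` A \<subseteq> (UNIV :: 'k set)"
    using assms by (auto simp: card_of_ordLeq[symmetric])
  define f where "f = (\<lambda>i. if i \<in> e ` A then Some (rep_hset (inv_into A e i)) else None)"
  have "ran f = rep_hset ` A"
  proof (intro equalityI subsetI)
    fix c assume "c \<in> ran f"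
    then show "c \<in> rep_hset ` A"
      by (auto simp: ran_def f_def inv_into_into split: if_splits)
  next
    fix c assume "c \<in> rep_hset ` A"
    then obtain x where "x \<in> A" "c = rep_hset x" by blast
    then have "f (e x) = Some c" using e(1) by (simp add: f_def)
    then show "c \<in> ran f" by (rule ranI)
  qed
  then have "elts (abs_hset (Code f)) = A"
    by (simp add: elts_Code image_image Quotient3_abs_rep[OF Quotient3_hset])
  then show ?thesis
    unfolding hset_of_def by (rule theI) (metis hset_ext \<open>elts (abs_hset (Code f)) = A\<close>)
qed

definition trcl :: "'k hset \<Rightarrow> 'k hset set"
  where "trcl x = {y. hmem\<^sup>+\<^sup>+ y x}"

text \<open>Every set whose transitive closure has size below \<open>\<kappa>\<close> is an element of \<open>'k hset\<close>.\<close>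

definition H_kappa :: "'k::wellorder hset set"
  where "H_kappa = {x. |trcl x| <o (kappa :: 'k rel)}"

text \<open>The von Neumann ordinal \<open>\<alpha> = {\<beta>. \<beta> < \<alpha>}\<close>.\<close>

function hord :: "'k::wellorder \<Rightarrow> 'k hset"
  where "hord \<alpha> = hset_of (hord ` {..<\<alpha>})"
  by auto
termination
  by (relation "{(\<alpha>, \<beta>). \<alpha> < \<beta>}") (auto simp: wf)

declare hord.simps [simp del]

lemma Field_kappa [simp]: "Field kappa = UNIV"
  by (auto simp: kappa_def Field_def)

lemma card_UNIV_kappa:
  "Card_order (kappa :: 'k::wellorder rel) \<Longrightarrow> |UNIV :: 'k set| =o (kappa :: 'k rel)"
  using card_of_Field_ordIso[of "kappa :: 'k rel"] by simp

lemma card_lessThan_kappa: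
  assumes "Card_order (kappa :: 'k::wellorder rel)"
  shows "|{..<\<alpha> :: 'k}| <o (kappa :: 'k rel)"
proof -
  have "underS kappa \<alpha> = {..<\<alpha>}"
    by (auto simp: underS_def kappa_def)
  then show ?thesis
    using card_of_underS[OF assms, of \<alpha>] by simp
qed

lemma elts_hord: "elts (hord \<alpha>) = hord ` {..<\<alpha>}"
proof -
  have "|hord ` {..<\<alpha>}| \<le>o |UNIV :: 'a set|"
    by (rule surj_imp_ordLeq[of _ hord]) auto
  then show ?thesis
    by (subst hord.simps) (rule elts_hset_of)
qed

lemma hord_inject:
  fixes \<alpha> \<beta> :: "'k::wellorder"
  shows "hord \<alpha> = hord \<beta> \<longleftrightarrow> \<alpha> = \<beta>"
proof -
  have neq: "hord \<gamma> \<noteq> hord \<delta>" if "\<gamma> < \<delta>" for \<gamma> \<delta> :: 'k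
    using that
  proof (induction \<gamma> arbitrary: \<delta> rule: less_induct)
    case (less \<gamma>)
    show ?case
    proof
      assume eq: "hord \<gamma> = hord \<delta>"
      have "hord \<gamma> \<in> hord ` {..<\<delta>}" using less.prems by blast
      also have "\<dots> = hord ` {..<\<gamma>}" using eq elts_hord by metis
      finally show False using less.IH by fastforce
    qed
  qed
  show ?thesis using neq[of \<alpha> \<beta>] neq[of \<beta> \<alpha>] by force
qed

lemma trcl_hord:
  fixes \<alpha> :: "'k::wellorder"
  shows "trcl (hord \<alpha>) = hord ` {..<\<alpha>}"
proof -
  have mem: "hmem x (hord \<gamma>) \<longleftrightarrow> x \<in> hord ` {..<\<gamma>}" for x and \<gamma> :: 'k
    using elts_hord[of \<gamma>] by (auto simp: elts_def)
  have "y \<in> hord ` {..<\<alpha>}" if "hmem\<^sup>+\<^sup>+ y (hord \<alpha>)" for y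
    using that by (induction rule: converse_tranclp_induct) (auto simp: mem)
  then show ?thesis unfolding trcl_def using mem by blast
qed

lemma hord_in_H_kappa:
  fixes \<alpha> :: "'k::wellorder"
  assumes "Card_order (kappa :: 'k rel)"
  shows "hord \<alpha> \<in> H_kappa"
  using ordLeq_ordLess_trans[OF card_of_image card_lessThan_kappa[OF assms]]
  by (simp add: H_kappa_def trcl_hord)


subsection \<open>Streamlined trees\<close>

text \<open>
  A function from the ordinal \<open>\<alpha>\<close> to \<open>H_kappa\<close> is a partial map with domain \<open>{..<\<alpha>}\<close> and range
  included in \<open>H_kappa\<close>; inclusion of functions is \<open>\<subseteq>\<^sub>m\<close>.
\<close>

type_synonym 'k node = "'k \<rightharpoonup> 'k hset"

definition funs :: "'k::wellorder \<Rightarrow> 'k node set"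
  where "funs \<alpha> = {t. dom t = {..<\<alpha>} \<and> ran t \<subseteq> H_kappa}"

definition level :: "'k::wellorder node set \<Rightarrow> 'k \<Rightarrow> 'k node set"
  where "level T \<alpha> = T \<inter> funs \<alpha>"

definition streamlined_tree :: "'k::wellorder node set \<Rightarrow> bool"
  where "streamlined_tree T \<longleftrightarrow>
    T \<subseteq> (\<Union>\<alpha>. funs \<alpha>) \<and>
    (\<forall>t\<in>T. \<forall>\<alpha>. t |` {..<\<alpha>} \<in> T) \<and>
    (\<forall>\<alpha>. level T \<alpha> \<noteq> {} \<and> |level T \<alpha>| <o (kappa :: 'k rel))"

definition node_less :: "'k node \<Rightarrow> 'k node \<Rightarrow> bool"
  where "node_less s t \<longleftrightarrow> s \<subseteq>\<^sub>m t \<and> s \<noteq> t"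

definition normal_tree :: "'k::wellorder node set \<Rightarrow> bool"
  where "normal_tree T \<longleftrightarrow>
    (\<forall>\<alpha> \<beta>. \<alpha> < \<beta> \<longrightarrow> (\<forall>s\<in>level T \<alpha>. \<exists>t\<in>level T \<beta>. node_less s t))"

definition prolific :: "'k::wellorder node set \<Rightarrow> bool"
  where "prolific T \<longleftrightarrow>
    (\<forall>\<alpha>. \<forall>t\<in>level T \<alpha>. \<forall>i < max omega \<alpha>. t(\<alpha> \<mapsto> hord i) \<in> T)"

text \<open>The height of \<open>t\<close> is the order type of its set of predecessors in the tree.\<close>

definition height :: "'k::wellorder node set \<Rightarrow> 'k node \<Rightarrow> 'k"
  where "height T t = (THE \<alpha>. \<exists>f. bij_betw f {..<\<alpha>} {s\<in>T. node_less s t} \<and>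
    (\<forall>\<beta><\<alpha>. \<forall>\<gamma><\<alpha>. \<beta> < \<gamma> \<longleftrightarrow> node_less (f \<beta>) (f \<gamma>)))"

lemma height_streamlined:
  fixes T :: "'k::wellorder node set"
  assumes T: "streamlined_tree T" and t: "t \<in> level T \<alpha>"
  shows "height T t = \<alpha>"
proof -
  let ?iso = "\<lambda>\<alpha> :: 'k. \<exists>f. bij_betw f {..<\<alpha>} {s\<in>T. node_less s t} \<and>
    (\<forall>\<beta><\<alpha>. \<forall>\<gamma><\<alpha>. \<beta> < \<gamma> \<longleftrightarrow> node_less (f \<beta>) (f \<gamma>))"
  have dom: "dom t = {..<\<alpha>}" and tT: "t \<in> T" using t by (auto simp: level_def funs_def)
  define f where "f = (\<lambda>\<beta>. t |` {..<\<beta>})"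
  have domf: "dom (f \<beta>) = {..<\<beta>}" if "\<beta> \<le> \<alpha>" for \<beta>
    using that dom unfolding f_def by auto
  have lef: "f \<beta> \<subseteq>\<^sub>m f \<gamma>" if "\<beta> \<le> \<gamma>" for \<beta> \<gamma>
    using that unfolding f_def by (auto simp: map_le_def restrict_map_def)
  have f\<alpha>: "f \<alpha> = t" unfolding f_def dom[symmetric]
    by (rule ext) (simp add: restrict_map_def domIff)
  have neq: "f \<beta> \<noteq> f \<gamma>" if "\<beta> < \<gamma>" "\<gamma> \<le> \<alpha>" for \<beta> \<gamma>
  proof
    assume "f \<beta> = f \<gamma>"
    then have "dom (f \<beta>) = dom (f \<gamma>)" by (rule arg_cong)
    then have "{..<\<beta>} = {..<\<gamma>}" unfolding domf[OF that(2)] using domf[of \<beta>] that by simp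
    then show False using that(1) by simp
  qed
  have ord: "\<beta> < \<gamma> \<longleftrightarrow> node_less (f \<beta>) (f \<gamma>)" if "\<beta> \<le> \<alpha>" "\<gamma> \<le> \<alpha>" for \<beta> \<gamma>
  proof
    assume "\<beta> < \<gamma>"
    then show "node_less (f \<beta>) (f \<gamma>)"
      using neq[of \<beta> \<gamma>] lef[of \<beta> \<gamma>] that by (simp add: node_less_def)
  next
    assume "node_less (f \<beta>) (f \<gamma>)"
    then have "\<not> f \<gamma> \<subseteq>\<^sub>m f \<beta>" using map_le_antisym by (auto simp: node_less_def)
    then show "\<beta> < \<gamma>" using lef[of \<gamma> \<beta>] by force
  qed
  have "f ` {..<\<alpha>} = {s\<in>T. node_less s t}"
  proof (intro equalityI subsetI)
    fix s assume "s \<in> f ` {..<\<alpha>}"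
    then obtain \<beta> where \<beta>: "\<beta> < \<alpha>" "s = f \<beta>" by blast
    have "f \<beta> \<in> T" using T tT by (simp add: streamlined_tree_def f_def)
    moreover have "node_less (f \<beta>) t" using ord[of \<beta> \<alpha>] \<beta>(1) unfolding f\<alpha> by simp
    ultimately show "s \<in> {s\<in>T. node_less s t}" using \<beta>(2) by simp
  next
    fix s assume "s \<in> {s\<in>T. node_less s t}"
    then have s: "s \<in> T" "s \<subseteq>\<^sub>m t" "s \<noteq> t" by (auto simp: node_less_def)
    then obtain \<beta> where \<beta>: "dom s = {..<\<beta>}"
      using T unfolding streamlined_tree_def funs_def by blast
    have "s x = f \<beta> x" for x
    proof (cases "x < \<beta>")
      case True
      then show ?thesis using s(2) \<beta> by (simp add: f_def map_le_def)
    next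
      case False
      then have "x \<notin> dom s" using \<beta> by simp
      then show ?thesis using False by (simp add: f_def domIff)
    qed
    then have sf: "s = f \<beta>" by blast
    have "{..<\<beta>} \<subseteq> {..<\<alpha>}" using map_le_implies_dom_le[OF s(2)] \<beta> dom by simp
    then have "\<beta> \<le> \<alpha>" by (meson lessThan_iff less_irrefl not_le subsetD)
    moreover have "\<beta> \<noteq> \<alpha>" using s(3) sf f\<alpha> by blast
    ultimately show "s \<in> f ` {..<\<alpha>}" using sf by auto
  qed
  moreover have "inj_on f {..<\<alpha>}"
    by (rule linorder_inj_onI) (use neq in auto)
  ultimately have bij: "bij_betw f {..<\<alpha>} {s\<in>T. node_less s t}" by (simp add: bij_betw_def)
  then have iso: "?iso \<alpha>" using ord by (intro exI[of _ f]) auto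
  have uniq: False if lt: "\<gamma> < \<delta>" and iso2: "?iso \<gamma>" "?iso \<delta>" for \<gamma> \<delta>
  proof -
    from iso2(1) obtain g where g: "bij_betw g {..<\<gamma>} {s\<in>T. node_less s t}"
        "\<forall>\<beta><\<gamma>. \<forall>\<beta>'<\<gamma>. \<beta> < \<beta>' \<longleftrightarrow> node_less (g \<beta>) (g \<beta>')"
      by (elim exE conjE)
    from iso2(2) obtain h where h: "bij_betw h {..<\<delta>} {s\<in>T. node_less s t}"
        "\<forall>\<beta><\<delta>. \<forall>\<beta>'<\<delta>. \<beta> < \<beta>' \<longleftrightarrow> node_less (h \<beta>) (h \<beta>')"
      by (elim exE conjE)
    define k where "k = (\<lambda>\<beta>. inv_into {..<\<gamma>} g (h \<beta>))"
    have k: "k \<beta> < \<gamma>" "g (k \<beta>) = h \<beta>" if "\<beta> < \<delta>" for \<beta>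
    proof -
      have "h \<beta> \<in> g ` {..<\<gamma>}" using that g(1) h(1) unfolding bij_betw_def by blast
      then show "k \<beta> < \<gamma>" "g (k \<beta>) = h \<beta>"
        unfolding k_def using inv_into_into[of "h \<beta>" g "{..<\<gamma>}"] by (auto simp: f_inv_into_f)
    qed
    have mono: "k \<beta> < k \<beta>'" if "\<beta> < \<beta>'" "\<beta>' < \<delta>" for \<beta> \<beta>'
    proof -
      have "\<beta> < \<delta>" using that by simp
      then have "node_less (g (k \<beta>)) (g (k \<beta>'))" using that h(2) k(2) by simp
      then show ?thesis using g(2) k(1)[OF \<open>\<beta> < \<delta>\<close>] k(1)[OF that(2)] by blast
    qed
    have "\<beta> \<le> k \<beta>" if "\<beta> < \<delta>" for \<beta>
      using that
    proof (induction \<beta> rule: less_induct)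
      case (less \<beta>)
      show ?case
      proof (rule ccontr)
        assume "\<not> \<beta> \<le> k \<beta>"
        then have "k \<beta> < \<beta>" by simp
        then show False
          using less.IH[of "k \<beta>"] less.prems mono[of "k \<beta>" \<beta>] by (meson not_le order.strict_trans)
      qed
    qed
    from this[OF lt] k(1)[OF lt] show False by simp
  qed
  show ?thesis
    unfolding height_def
  proof (rule the_equality[where P = ?iso, OF iso])
    fix \<gamma> assume "?iso \<gamma>"
    note i = this
    have "\<not> \<gamma> < \<alpha>" by (rule notI) (rule uniq[OF _ i iso])
    moreover have "\<not> \<alpha> < \<gamma>" by (rule notI) (rule uniq[OF _ iso i])
    ultimately show "\<gamma> = \<alpha>" by simp
  qed
qed

text \<open>The set of heights \<open>X\<close> is \<open>{..<\<alpha>}\<close> for an \<open>\<alpha>\<close>-branch and \<open>UNIV\<close> for a \<open>\<kappa>\<close>-branch.\<close>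

definition branch :: "'k::wellorder node set \<Rightarrow> 'k set \<Rightarrow> 'k node set \<Rightarrow> bool"
  where "branch T X B \<longleftrightarrow>
    B \<subseteq> T \<and> (\<forall>s\<in>B. \<forall>t\<in>B. s = t \<or> node_less s t \<or> node_less t s) \<and> height T ` B = X"

definition antichain :: "'k node set \<Rightarrow> 'k node set \<Rightarrow> bool"
  where "antichain T A \<longleftrightarrow>
    A \<subseteq> T \<and> (\<forall>s\<in>A. \<forall>t\<in>A. s \<noteq> t \<longrightarrow> \<not> node_less s t \<and> \<not> node_less t s)"

definition souslin :: "'k::wellorder node set \<Rightarrow> bool"
  where "souslin T \<longleftrightarrow>
    (\<nexists>B. branch T UNIV B) \<and> (\<nexists>A. antichain T A \<and> |A| =o (kappa :: 'k rel))"

definition vanishing :: "'k node set \<Rightarrow> 'k node set \<Rightarrow> bool"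
  where "vanishing T B \<longleftrightarrow> (\<nexists>t. t \<in> T \<and> (\<forall>s\<in>B. s = t \<or> node_less s t))"

definition V_minus :: "'k::wellorder node set \<Rightarrow> 'k set"
  where "V_minus T = {\<alpha>\<in>acc UNIV. \<exists>B. branch T {..<\<alpha>} B \<and> vanishing T B}"

definition V :: "'k::wellorder node set \<Rightarrow> 'k set"
  where "V T = {\<alpha>\<in>acc UNIV. \<forall>t\<in>T. height T t < \<alpha> \<longrightarrow>
    (\<exists>B. branch T {..<\<alpha>} B \<and> vanishing T B \<and> t \<in> B)}"

end

theory Submission
  imports Defs
begin

text \<open>
  Choose one club \<open>C \<alpha>\<close> of the given sequence for each \<open>\<alpha>\<close>; by \<open>\<sqsubseteq>\<^sup>S\<close>-coherence no accumulation point of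
  \<open>C \<alpha>\<close> is in \<open>S\<close>. The tree consists of functions \<open>f\<close> with \<open>f \<zeta> < max \<omega> \<zeta>\<close>. A limit level outside \<open>S\<close>
  contains all branches, and there are fewer than \<open>\<kappa>\<close> of them because \<open>\<kappa>\<close> is a strong limit. A level
  \<open>\<alpha> \<in> S\<close> contains the branches that, along a final segment of \<open>C \<alpha>\<close>, take the value \<open>0\<close> and pass
  through the maximal antichains guessed by the diamond sequence at the points of \<open>nacc (C \<alpha>)\<close>. Such
  branches through a given node exist by recursion along \<open>C \<alpha>\<close>, as limit stages of the recursion are
  outside \<open>S\<close>. The same recursion with a nonzero value in place of \<open>0\<close> gives a vanishing branch.
\<close>

section \<open>Order-theoretic forms of suprema, accumulation points and cofinality\<close>

text \<open>The bound \<open>b\<close> ensures that the \<open>LEAST\<close> in \<open>osup\<close>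
  ranges over a nonempty set of upper bounds.\<close>

lemma osup_eq_iff:
  fixes X :: "'k::wellorder set"
  assumes "\<And>x. x \<in> X \<Longrightarrow> x \<le> b"
  shows "osup X = \<beta> \<longleftrightarrow> (\<forall>x\<in>X. x \<le> \<beta>) \<and> (\<forall>\<xi><\<beta>. \<exists>x\<in>X. \<xi> < x)"
proof -
  have "\<forall>x\<in>X. x \<le> osup X"
    unfolding osup_def by (rule LeastI[of _ b]) (use assms in blast)
  moreover have "\<exists>x\<in>X. \<xi> < x" if "\<xi> < osup X" for \<xi>
    using not_less_Least[OF that[unfolded osup_def]] by (auto simp: not_le)
  ultimately show ?thesis
    by (metis leD linorder_cases)
qed

lemma ozero_le: "ozero \<le> (\<alpha> :: 'k::wellorder)"
  unfolding ozero_def by (simp add: Least_le)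

lemma ozero_less_iff: "ozero < (\<alpha> :: 'k::wellorder) \<longleftrightarrow> (\<exists>\<beta>. \<beta> < \<alpha>)"
  by (meson le_less_trans ozero_le)

lemma acc_iff:
  fixes C :: "'k::wellorder set"
  shows "\<alpha> \<in> acc C \<longleftrightarrow> \<alpha> \<in> C \<and> ozero < \<alpha> \<and> (\<forall>\<xi><\<alpha>. \<exists>\<zeta>\<in>C. \<xi> < \<zeta> \<and> \<zeta> < \<alpha>)"
proof -
  have "osup (C \<inter> {..<\<alpha>}) = \<alpha> \<longleftrightarrow> (\<forall>\<xi><\<alpha>. \<exists>\<zeta>\<in>C. \<xi> < \<zeta> \<and> \<zeta> < \<alpha>)"
    by (subst osup_eq_iff[of _ \<alpha>]) auto
  then show ?thesis by (auto simp: acc_def)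
qed

lemma cofinal_kappa_iff: "cofinal K (kappa :: 'k::wellorder rel) \<longleftrightarrow> (\<forall>\<alpha>. \<exists>\<beta>\<in>K. \<alpha> < \<beta>)"
  unfolding cofinal_def kappa_def order.strict_iff_order
  by (simp add: Field_kappa[unfolded kappa_def] conj_commute)

text \<open>Without a largest element, \<open>UNIV\<close> is itself a club.\<close>

lemma stationary_nonempty:
  assumes "stationary (A :: 'k::wellorder set)" and "\<And>\<alpha> :: 'k. \<exists>\<beta>. \<alpha> < \<beta>"
  shows "A \<noteq> {}"
proof -
  have "club (UNIV :: 'k set)"
    using assms(2) by (auto simp: club_def closed_subset_def cofinal_kappa_iff)
  then show ?thesis using assms(1) by (auto simp: stationary_def)
qed

section \<open>Cardinal and ordinal arithmetic below an inaccessible\<close>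

text \<open>The \<open>itself\<close> parameter only carries the type \<open>'k\<close>, on which
  alone \<open>kappa\<close> depends.\<close>

locale inaccessible =
  fixes \<kappa> :: "'k::wellorder itself"
  assumes inacc: "strongly_inaccessible (kappa :: 'k rel)"
begin

lemma Card_order_kappa: "Card_order (kappa :: 'k rel)"
  using inacc by (simp add: strongly_inaccessible_def)

lemma natLeq_less_kappa: "natLeq <o (kappa :: 'k rel)"
  using inacc by (simp add: strongly_inaccessible_def)

lemma infinite_UNIV_kappa: "infinite (UNIV :: 'k set)"
proof
  assume "finite (UNIV :: 'k set)"
  then have "|UNIV :: 'k set| <o natLeq"
    using finite_iff_ordLess_natLeq by blast
  with ordIso_ordLess_trans[OF ordIso_symmetric[OF card_UNIV_kappa[OF Card_order_kappa]]]
  have "(kappa :: 'k rel) <o natLeq" by blast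
  then show False
    using natLeq_less_kappa not_ordLess_ordLeq ordLess_imp_ordLeq by blast
qed

text \<open>Regularity in the form used for products and for unions of fewer than \<kappa> small
  sets.\<close>

lemma stable_kappa: "stable (kappa :: 'k rel)"
  by (rule regularCard_stable[OF Card_order_kappa])
    (use inacc infinite_UNIV_kappa in \<open>auto simp: strongly_inaccessible_def\<close>)

text \<open>An unbounded image would be cofinal, hence of size \<kappa> by regularity.\<close>

lemma bounded_image:
  fixes h :: "'b \<Rightarrow> 'k"
  assumes "|X| <o (kappa :: 'k rel)"
  shows "\<exists>\<delta>. \<forall>x\<in>X. h x < \<delta>"
proof (rule ccontr)
  assume "\<nexists>\<delta>. \<forall>x\<in>X. h x < \<delta>"
  then have unb: "\<exists>x\<in>X. \<delta> \<le> h x" for \<delta> by (meson not_le)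
  have "\<exists>\<beta>. \<alpha> < \<beta>" for \<alpha> :: 'k
    using infinite_Card_order_limit[OF Card_order_kappa, of \<alpha>] infinite_UNIV_kappa
    by (simp, auto simp: kappa_def order.strict_iff_order)
  then have "cofinal (h ` X) (kappa :: 'k rel)"
    unfolding cofinal_kappa_iff by (meson imageI less_le_trans unb)
  then have "|h ` X| =o (kappa :: 'k rel)"
    using inacc by (auto simp: strongly_inaccessible_def regularCard_def)
  moreover have "|h ` X| <o (kappa :: 'k rel)"
    using ordLeq_ordLess_trans[OF card_of_image assms] .
  ultimately show False using not_ordLess_ordIso by blast
qed

lemma card_finite_less_kappa: "finite X \<Longrightarrow> |X| <o (kappa :: 'k rel)"
  using finite_iff_ordLess_natLeq natLeq_less_kappa ordLess_transitive by blast

lemma ex_greater: "\<exists>\<beta>. (\<alpha> :: 'k) < \<beta>"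
  using bounded_image[of "{\<alpha>}" "\<lambda>x. x", OF card_finite_less_kappa] by auto

definition osuc :: "'k \<Rightarrow> 'k"
  where "osuc \<alpha> = (LEAST \<beta>. \<alpha> < \<beta>)"

lemma less_osuc: "\<alpha> < osuc \<alpha>"
  unfolding osuc_def using LeastI_ex[OF ex_greater] .

lemma osuc_le: "\<alpha> < \<beta> \<Longrightarrow> osuc \<alpha> \<le> \<beta>"
  unfolding osuc_def by (rule Least_le)

lemma less_osuc_iff: "\<beta> < osuc \<alpha> \<longleftrightarrow> \<beta> \<le> \<alpha>"
  by (meson leD leI less_le_trans less_osuc osuc_le order.strict_trans1)

lemma limit_osuc_less: "\<alpha> \<in> acc UNIV \<Longrightarrow> \<beta> < \<alpha> \<Longrightarrow> osuc \<beta> < \<alpha>"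
  by (metis acc_UNIV_iff order.strict_trans1 osuc_le)

lemma osuc_not_limit: "osuc \<beta> \<notin> acc UNIV"
  using limit_osuc_less less_osuc by blast

lemma ordinal_cases:
  obtains "\<alpha> = ozero" | \<beta> where "\<alpha> = osuc \<beta>" | "\<alpha> \<in> acc UNIV"
proof -
  have "\<exists>\<beta>. \<alpha> = osuc \<beta>" if "\<alpha> \<noteq> ozero" "\<alpha> \<notin> acc UNIV"
  proof -
    obtain \<beta> where "\<beta> < \<alpha>" "\<forall>\<gamma>>\<beta>. \<not> \<gamma> < \<alpha>"
      using \<open>\<alpha> \<notin> acc UNIV\<close> \<open>\<alpha> \<noteq> ozero\<close> unfolding acc_UNIV_iff
      by (metis ozero_less_iff ozero_le order.not_eq_order_implies_strict)
    then have "\<alpha> = osuc \<beta>"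
      by (metis less_osuc osuc_le order.not_eq_order_implies_strict)
    then show ?thesis ..
  qed
  then show thesis using that by blast
qed

text \<open>If all initial segments were finite, their cardinalities would embed \<open>'k\<close>
  into \<open>nat\<close>, contradicting uncountability. So the \<open>LEAST\<close> in
  \<open>omega\<close> is attained.\<close>

lemma infinite_lessThan_omega: "infinite {..<omega :: 'k}"
proof -
  have "\<exists>\<alpha> :: 'k. infinite {..<\<alpha>}"
  proof (rule ccontr)
    assume "\<nexists>\<alpha> :: 'k. infinite {..<\<alpha>}"
    then have "strict_mono (\<lambda>\<alpha> :: 'k. card {..<\<alpha>})"
      by (intro strict_monoI psubset_card_mono) auto
    then have "inj (\<lambda>\<alpha> :: 'k. card {..<\<alpha>})"
      by (rule strict_mono_imp_inj_on)
    then have "|UNIV :: 'k set| \<le>o |UNIV :: nat set|"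
      using card_of_ordLeq by blast
    then have "(kappa :: 'k rel) \<le>o natLeq"
      using card_UNIV_kappa[OF Card_order_kappa] card_of_nat
      by (meson ordIso_iff_ordLeq ordLeq_transitive)
    then show False using natLeq_less_kappa not_ordLess_ordLeq by blast
  qed
  then show ?thesis unfolding omega_def by (rule LeastI_ex)
qed

lemma ozero_less_omega: "ozero < (omega :: 'k)"
  using infinite_lessThan_omega ozero_less_iff by (metis finite.emptyI lessThan_iff ex_in_conv)

text \<open>Provides the second admissible value \<open>v\<close>, used for vanishing branches and
  for leaving a given branch.\<close>

lemma ex_nonzero_less_omega: "\<exists>v. v < (omega :: 'k) \<and> v \<noteq> ozero"
proof (rule ccontr)
  assume "\<nexists>v. v < (omega :: 'k) \<and> v \<noteq> ozero"
  then have "{..<omega :: 'k} \<subseteq> {ozero}" by auto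
  then show False using infinite_lessThan_omega finite_subset by blast
qed

lemma card_Times_less_kappa:
  "|X| <o (kappa :: 'k rel) \<Longrightarrow> |Y| <o (kappa :: 'k rel) \<Longrightarrow> |X \<times> Y| <o (kappa :: 'k rel)"
  by (rule stable_elim[OF stable_kappa])

text \<open>The strong limit clause speaks only of subsets of \<open>Field kappa\<close>, so
  \<open>X\<close> is first embedded into \<open>'k\<close>.\<close>

lemma card_Pow_less_kappa:
  assumes "|X| <o (kappa :: 'k rel)"
  shows "|Pow X| <o (kappa :: 'k rel)"
proof -
  have "|X| \<le>o |UNIV :: 'k set|"
    using assms card_UNIV_kappa[OF Card_order_kappa]
    by (meson ordIso_iff_ordLeq ordLeq_transitive ordLess_imp_ordLeq)
  then obtain e :: "_ \<Rightarrow> 'k" where e: "inj_on e X" by (auto simp: card_of_ordLeq[symmetric])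
  have "|e ` X| <o (kappa :: 'k rel)"
    using ordLeq_ordLess_trans[OF card_of_image assms] .
  then have "|Pow (e ` X)| <o (kappa :: 'k rel)"
    using inacc by (auto simp: strongly_inaccessible_def)
  moreover have "|Pow X| \<le>o |Pow (e ` X)|"
    using inj_on_image_Pow[OF e] by (metis card_of_ordLeq image_Pow_surj order_refl)
  ultimately show ?thesis using ordLeq_ordLess_trans by blast
qed

text \<open>A limit of closure points is a closure point. For unboundedness, a function dominating
  \<open>g\<close> is iterated \<omega> times; the supremum stays below \<kappa> by regularity and
  uncountability.\<close>

lemma closure_points_club:
  fixes g :: "'k \<Rightarrow> 'k"
  shows "club {\<delta>. ozero < \<delta> \<and> (\<forall>\<beta><\<delta>. g \<beta> < \<delta>)}" (is "club ?E")
proof -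
  have "\<beta> \<in> ?E" if "osup (?E \<inter> {..<\<beta>}) = \<beta>" "ozero < \<beta>" for \<beta>
  proof -
    have "\<forall>\<xi><\<beta>. \<exists>\<delta>\<in>?E. \<xi> < \<delta> \<and> \<delta> < \<beta>"
      using that(1) by (subst (asm) osup_eq_iff[of _ \<beta>]) auto
    then show ?thesis using that(2) by fastforce
  qed
  moreover have "\<exists>\<delta>\<in>?E. \<alpha> < \<delta>" for \<alpha>
  proof -
    have "\<exists>\<delta>. \<forall>\<gamma>\<in>{..<osuc \<beta>}. max (g \<gamma>) \<gamma> < \<delta>" for \<beta>
      by (rule bounded_image) (rule card_lessThan_kappa[OF Card_order_kappa])
    \<comment> \<open>\<open>h \<beta>\<close> exceeds \<open>g\<close> on everything up to and
      including \<open>\<beta>\<close>, so one application of \<open>h\<close> absorbs all values of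
      \<open>g\<close> met so far.\<close>
    then obtain h where h: "\<And>\<beta> \<gamma>. \<gamma> \<le> \<beta> \<Longrightarrow> g \<gamma> < h \<beta>" "\<And>\<beta>. \<beta> < h \<beta>"
      unfolding lessThan_iff Ball_def less_osuc_iff by (metis max_less_iff_conj order_refl)
    define a where "a n = (h ^^ n) \<alpha>" for n
    have "|UNIV :: nat set| <o (kappa :: 'k rel)"
      using ordIso_ordLess_trans[OF card_of_nat natLeq_less_kappa] .
    then obtain \<delta>0 where "\<forall>n. a n < \<delta>0" using bounded_image[of UNIV a] by auto
    define \<delta> where "\<delta> = (LEAST \<delta>. \<forall>n. a n < \<delta>)"
    have \<delta>: "a n < \<delta>" for n
      unfolding \<delta>_def using LeastI[of "\<lambda>\<delta>. \<forall>n. a n < \<delta>", OF \<open>\<forall>n. a n < \<delta>0\<close>] by blast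
    have "g \<gamma> < \<delta>" if less: "\<gamma> < \<delta>" for \<gamma>
    proof -
      obtain n where "\<gamma> \<le> a n"
        using not_less_Least[of \<gamma> "\<lambda>\<delta>. \<forall>n. a n < \<delta>"] less
        by (auto simp: \<delta>_def not_less)
      then have "g \<gamma> < a (Suc n)" using h(1) by (simp add: a_def)
      then show ?thesis using \<delta> by (rule less_trans)
    qed
    moreover have "\<alpha> < \<delta>" using \<delta>[of 0] by (simp add: a_def)
    ultimately show ?thesis using ozero_less_iff by blast
  qed
  ultimately show ?thesis
    unfolding club_def closed_subset_def cofinal_kappa_iff by blast
qed

end

section \<open>Nodes coded by ordinal-valued functions\<close>

text \<open>Nodes are represented by total functions on ordinals, so that a single function
  describes all nodes of a branch; its values from \<open>\<beta>\<close> on are discarded.\<close>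

definition nd :: "'k::wellorder \<Rightarrow> ('k \<Rightarrow> 'k) \<Rightarrow> 'k node"
  where "nd \<beta> f = (\<lambda>\<zeta>. if \<zeta> < \<beta> then Some (hord (f \<zeta>)) else None)"

lemma dom_nd [simp]: "dom (nd \<beta> f) = {..<\<beta>}"
  by (auto simp: nd_def dom_def)

lemma nd_le_iff: "nd \<beta> f \<subseteq>\<^sub>m nd \<gamma> g \<longleftrightarrow> \<beta> \<le> \<gamma> \<and> (\<forall>\<zeta><\<beta>. f \<zeta> = g \<zeta>)"
proof
  assume le: "nd \<beta> f \<subseteq>\<^sub>m nd \<gamma> g"
  have "{..<\<beta>} \<subseteq> {..<\<gamma>}" using map_le_implies_dom_le[OF le] by simp
  then have "\<beta> \<le> \<gamma>" by (meson lessThan_iff less_irrefl not_le subsetD)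
  moreover have "f \<zeta> = g \<zeta>" if "\<zeta> < \<beta>" for \<zeta>
    using le that \<open>\<beta> \<le> \<gamma>\<close> unfolding map_le_def by (force simp: nd_def hord_inject split: if_splits)
  ultimately show "\<beta> \<le> \<gamma> \<and> (\<forall>\<zeta><\<beta>. f \<zeta> = g \<zeta>)" by blast
next
  assume "\<beta> \<le> \<gamma> \<and> (\<forall>\<zeta><\<beta>. f \<zeta> = g \<zeta>)"
  then show "nd \<beta> f \<subseteq>\<^sub>m nd \<gamma> g" by (auto simp: map_le_def nd_def)
qed

lemma nd_eq_iff: "nd \<beta> f = nd \<gamma> g \<longleftrightarrow> \<beta> = \<gamma> \<and> (\<forall>\<zeta><\<beta>. f \<zeta> = g \<zeta>)"
proof
  assume "nd \<beta> f = nd \<gamma> g"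
  then have "nd \<beta> f \<subseteq>\<^sub>m nd \<gamma> g" "nd \<gamma> g \<subseteq>\<^sub>m nd \<beta> f" by simp_all
  then show "\<beta> = \<gamma> \<and> (\<forall>\<zeta><\<beta>. f \<zeta> = g \<zeta>)" unfolding nd_le_iff by auto
qed (auto simp: nd_def)

lemma node_less_nd_iff: "node_less (nd \<beta> f) (nd \<gamma> g) \<longleftrightarrow> \<beta> < \<gamma> \<and> (\<forall>\<zeta><\<beta>. f \<zeta> = g \<zeta>)"
  using not_le by (auto simp: node_less_def nd_le_iff nd_eq_iff order.strict_iff_order)

lemma nd_restrict: "nd \<beta> f |` {..<\<alpha>} = nd (min \<alpha> \<beta>) f"
  by (auto simp: nd_def restrict_map_def)

definition bounded_nodes :: "'k::wellorder \<Rightarrow> 'k node set"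
  where "bounded_nodes \<beta> = {nd \<beta> f | f. \<forall>\<zeta><\<beta>. f \<zeta> < max omega \<zeta>}"

context inaccessible
begin

lemma nd_in_funs: "nd \<beta> f \<in> funs (\<beta> :: 'k)"
  using hord_in_H_kappa[OF Card_order_kappa]
  by (auto simp: funs_def nd_def ran_def dom_def split: if_splits)

text \<open>A node is determined by its graph, a subset of
  \<open>{..<\<beta>} \<times> {..<max omega \<beta>}\<close>, and \<kappa> is a strong
  limit.\<close>

lemma card_bounded_nodes: "|bounded_nodes (\<beta> :: 'k)| <o (kappa :: 'k rel)"
proof -
  let ?P = "{..<\<beta>} \<times> {..<max omega \<beta>}"
  let ?G = "\<lambda>t :: 'k node. {(\<zeta>, i). t \<zeta> = Some (hord i)}"
  have less: "|Pow ?P| <o (kappa :: 'k rel)"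
    by (intro card_Pow_less_kappa card_Times_less_kappa card_lessThan_kappa Card_order_kappa)
  have G: "?G (nd \<beta> f) = {(\<zeta>, i). \<zeta> < \<beta> \<and> f \<zeta> = i}" for f
    by (auto simp: nd_def hord_inject split: if_splits)
  have "inj_on ?G (bounded_nodes \<beta>)"
  proof (rule inj_onI)
    fix s t assume "s \<in> bounded_nodes \<beta>" "t \<in> bounded_nodes \<beta>" "?G s = ?G t"
    then obtain f g where fg: "s = nd \<beta> f" "t = nd \<beta> g" and "?G (nd \<beta> f) = ?G (nd \<beta> g)"
      unfolding bounded_nodes_def by blast
    then have eq: "{(\<zeta>, i). \<zeta> < \<beta> \<and> f \<zeta> = i} = {(\<zeta>, i). \<zeta> < \<beta> \<and> g \<zeta> = i}"
      unfolding G by simp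
    have "f \<zeta> = g \<zeta>" if "\<zeta> < \<beta>" for \<zeta>
    proof -
      have "(\<zeta>, f \<zeta>) \<in> {(\<zeta>, i). \<zeta> < \<beta> \<and> g \<zeta> = i}" unfolding eq[symmetric] using that by simp
      then show ?thesis by simp
    qed
    then show "s = t" by (simp add: fg nd_eq_iff)
  qed
  moreover have "?G ` bounded_nodes \<beta> \<subseteq> Pow ?P"
  proof (rule image_subsetI)
    fix t assume "t \<in> bounded_nodes \<beta>"
    then obtain f where t: "t = nd \<beta> f" and f: "\<forall>\<zeta><\<beta>. f \<zeta> < max omega \<zeta>"
      unfolding bounded_nodes_def by blast
    have "f \<zeta> < max omega \<beta>" if "\<zeta> < \<beta>" for \<zeta>
      using f that unfolding less_max_iff_disj by (meson less_trans)
    then show "?G t \<in> Pow ?P" unfolding t G by blast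
  qed
  ultimately have "|bounded_nodes \<beta>| \<le>o |Pow ?P|" using card_of_ordLeq by blast
  then show ?thesis using less ordLeq_ordLess_trans by blast
qed

text \<open>There are \<kappa> levels of fewer than \<kappa> nodes each. The coding lets a diamond
  sequence, which guesses sets of ordinals, guess sets of nodes.\<close>

lemma ex_node_coding: "\<exists>\<phi> :: 'k node \<Rightarrow> 'k. inj_on \<phi> (\<Union>\<beta>. bounded_nodes \<beta>)"
proof -
  have "|bounded_nodes \<beta>| \<le>o |UNIV :: 'k set|" for \<beta> :: 'k
    using ordLess_imp_ordLeq[OF ordLess_ordIso_trans[OF card_bounded_nodes
          ordIso_symmetric[OF card_UNIV_kappa[OF Card_order_kappa]]]] .
  then have "|\<Union>\<beta> :: 'k. bounded_nodes \<beta>| \<le>o |UNIV :: 'k set|"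
    by (intro card_of_UNION_ordLeq_infinite[OF infinite_UNIV_kappa]) (auto intro: card_of_mono1)
  then show ?thesis by (auto simp: card_of_ordLeq[symmetric])
qed

end

section \<open>The membership predicate of the tree and extension of its nodes\<close>

text \<open>What the proxy principle yields once a single club \<open>C \<alpha>\<close> is chosen
  at each level: coherence enters as \<open>acc_C_notin_S\<close>, guessing as one suitable point of
  \<open>S\<close> for each cofinal \<open>B\<close>.\<close>

locale tree_construction = inaccessible \<kappa> for \<kappa> :: "'k::wellorder itself" +
  fixes S :: "'k set" and C :: "'k \<Rightarrow> 'k set" and A :: "'k \<Rightarrow> 'k set" and \<phi> :: "'k node \<Rightarrow> 'k"
  assumes S_limit: "S \<subseteq> acc UNIV"
    and C_less: "\<zeta> \<in> C \<alpha> \<Longrightarrow> \<zeta> < \<alpha>"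
    and C_unbounded: "\<alpha> \<in> acc UNIV \<Longrightarrow> \<xi> < \<alpha> \<Longrightarrow> \<exists>\<zeta>\<in>C \<alpha>. \<xi> < \<zeta>"
    and C_closed: "\<beta> < \<alpha> \<Longrightarrow> ozero < \<beta> \<Longrightarrow> (\<And>\<xi>. \<xi> < \<beta> \<Longrightarrow> \<exists>\<zeta>\<in>C \<alpha>. \<xi> < \<zeta> \<and> \<zeta> < \<beta>) \<Longrightarrow> \<beta> \<in> C \<alpha>"
    and acc_C_notin_S: "\<beta> \<in> acc (C \<alpha>) \<Longrightarrow> \<beta> \<notin> S"
    and \<phi>_inj: "inj_on \<phi> (\<Union>\<beta>. bounded_nodes \<beta>)"
    and diamond: "diamond_sequence A"
    and guess: "cofinal B kappa \<Longrightarrow> \<exists>\<alpha>\<in>S. \<forall>\<xi><\<alpha>. \<exists>\<zeta>\<in>nacc (C \<alpha>) \<inter> B. \<xi> < \<zeta>"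
begin

text \<open>
  \<open>tr \<beta> f\<close> says that the restriction of \<open>f\<close> to \<open>\<beta>\<close> belongs to the tree. A level in \<open>S\<close> admits only
  the branches that are eventually \<open>0\<close> along \<open>C \<beta>\<close>, which leaves room for vanishing branches, and
  that at eventually all \<open>\<zeta> \<in> nacc (C \<beta>)\<close> pass through the antichain guessed at \<open>\<zeta>\<close>, provided that
  the guess is maximal below level \<open>\<zeta>\<close>.
\<close>

function tr :: "'k \<Rightarrow> ('k \<Rightarrow> 'k) \<Rightarrow> bool"
  where "tr \<beta> f \<longleftrightarrow>
    (\<forall>\<zeta>\<in>{..<\<beta>}. f \<zeta> < max omega \<zeta> \<and> tr \<zeta> f) \<and>
    (\<beta> \<in> S \<longrightarrow> (\<exists>\<gamma><\<beta>. (\<forall>\<zeta>\<in>C \<beta>. \<gamma> < \<zeta> \<longrightarrow> f \<zeta> = ozero) \<and>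
      (\<forall>\<zeta>\<in>{..<\<beta>}. \<zeta> \<in> nacc (C \<beta>) \<longrightarrow> \<gamma> < \<zeta> \<longrightarrow>
        \<zeta> \<in> acc UNIV \<and>
        (\<forall>\<eta>\<in>{..<\<zeta>}. \<forall>g. tr \<eta> g \<longrightarrow>
          (\<exists>\<eta>'\<in>{..<\<zeta>}. \<exists>h. tr \<eta>' h \<and> \<phi> (nd \<eta>' h) \<in> A \<zeta> \<and> (\<forall>\<xi><min \<eta> \<eta>'. g \<xi> = h \<xi>))) \<longrightarrow>
        (\<exists>\<eta><\<zeta>. \<phi> (nd \<eta> f) \<in> A \<zeta>))))"
  by auto
termination
  by (relation "{(x, y). fst x < fst y}")
    (use wf_inv_image[OF wf, of fst] in \<open>auto simp: inv_image_def\<close>)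

declare tr.simps [simp del]

text \<open>The premise on the guess at \<open>\<zeta>\<close> inside \<open>tr\<close>. Agreement
  below \<open>min \<eta> \<eta>'\<close> expresses that \<open>nd \<eta> g\<close> and
  \<open>nd \<eta>' h\<close> are comparable.\<close>

definition good :: "'k \<Rightarrow> bool"
  where "good \<zeta> \<longleftrightarrow> \<zeta> \<in> acc UNIV \<and> (\<forall>\<eta><\<zeta>. \<forall>g. tr \<eta> g \<longrightarrow>
    (\<exists>\<eta>'<\<zeta>. \<exists>h. tr \<eta>' h \<and> \<phi> (nd \<eta>' h) \<in> A \<zeta> \<and> (\<forall>\<xi><min \<eta> \<eta>'. g \<xi> = h \<xi>)))"

text \<open>Vacuous where the guess is not \<open>good\<close>, so that only meaningful guesses
  constrain the tree.\<close>

definition hits :: "'k \<Rightarrow> ('k \<Rightarrow> 'k) \<Rightarrow> bool"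
  where "hits \<zeta> f \<longleftrightarrow> (good \<zeta> \<longrightarrow> (\<exists>\<eta><\<zeta>. \<phi> (nd \<eta> f) \<in> A \<zeta>))"

text \<open>The bounded quantifiers of \<open>tr\<close> serve its termination proof; since
  \<open>C \<beta>\<close> lies below \<open>\<beta>\<close>, the condition can be restated through
  \<open>hits\<close>.\<close>

lemma tr_iff:
  "tr \<beta> f \<longleftrightarrow> (\<forall>\<zeta><\<beta>. f \<zeta> < max omega \<zeta> \<and> tr \<zeta> f) \<and>
    (\<beta> \<in> S \<longrightarrow> (\<exists>\<gamma><\<beta>. (\<forall>\<zeta>\<in>C \<beta>. \<gamma> < \<zeta> \<longrightarrow> f \<zeta> = ozero) \<and>
      (\<forall>\<zeta>\<in>nacc (C \<beta>). \<gamma> < \<zeta> \<longrightarrow> hits \<zeta> f)))"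
proof -
  have nacc: "\<zeta> \<in> nacc (C \<beta>) \<Longrightarrow> \<zeta> < \<beta>" for \<zeta> by (simp add: nacc_def C_less)
  show ?thesis
    by (subst tr.simps) (use nacc in \<open>simp only: hits_def good_def Ball_def Bex_def lessThan_iff; blast\<close>)
qed

lemma trD: "tr \<beta> f \<Longrightarrow> \<zeta> \<le> \<beta> \<Longrightarrow> tr \<zeta> f"
  using tr_iff[of \<beta> f] by (cases "\<zeta> = \<beta>") auto

lemma tr_less: "tr \<beta> f \<Longrightarrow> \<zeta> < \<beta> \<Longrightarrow> f \<zeta> < max omega \<zeta>"
  using tr_iff[of \<beta> f] by blast

lemma tr_S:
  assumes "tr \<beta> f" "\<beta> \<in> S"
  shows "\<exists>\<gamma><\<beta>. (\<forall>\<zeta>\<in>C \<beta>. \<gamma> < \<zeta> \<longrightarrow> f \<zeta> = ozero) \<and> (\<forall>\<zeta>\<in>nacc (C \<beta>). \<gamma> < \<zeta> \<longrightarrow> hits \<zeta> f)"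
  using assms tr_iff[of \<beta> f] by blast

lemma hits_cong:
  assumes "\<And>\<xi>. \<xi> < \<zeta> \<Longrightarrow> f \<xi> = g \<xi>"
  shows "hits \<zeta> f \<longleftrightarrow> hits \<zeta> g"
proof -
  have "nd \<eta> f = nd \<eta> g" if "\<eta> < \<zeta>" for \<eta> using assms that by (auto simp: nd_eq_iff)
  then show ?thesis by (auto simp: hits_def)
qed

text \<open>By induction, because \<open>hits \<zeta>\<close> inspects only initial segments shorter
  than \<open>\<zeta>\<close>. This allows a function to be altered from \<open>\<beta>\<close>
  on.\<close>

lemma tr_cong: "(\<And>\<xi>. \<xi> < \<beta> \<Longrightarrow> f \<xi> = g \<xi>) \<Longrightarrow> tr \<beta> f \<longleftrightarrow> tr \<beta> g"
proof (induction \<beta> rule: less_induct)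
  case (less \<beta>)
  have IH: "tr \<zeta> f \<longleftrightarrow> tr \<zeta> g" if "\<zeta> < \<beta>" for \<zeta>
    using less.IH[OF that] less.prems that by auto
  have "hits \<zeta> f \<longleftrightarrow> hits \<zeta> g" if "\<zeta> \<in> nacc (C \<beta>)" for \<zeta>
  proof (rule hits_cong)
    fix \<xi> assume "\<xi> < \<zeta>"
    moreover have "\<zeta> < \<beta>" using that by (simp add: nacc_def C_less)
    ultimately show "f \<xi> = g \<xi>" using less.prems by auto
  qed
  then show ?case
    unfolding tr_iff[of \<beta>] using IH less.prems C_less by (auto simp: Ball_def)
qed

lemma tr_ozero: "tr ozero f"
  using S_limit leD[OF ozero_le] by (subst tr_iff) (auto simp: acc_iff)

lemma tr_osuc:
  assumes "tr \<beta> f" "i < max omega \<beta>"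
  shows "tr (osuc \<beta>) (f(\<beta> := i))"
proof -
  have "tr \<zeta> (f(\<beta> := i))" if "\<zeta> \<le> \<beta>" for \<zeta>
  proof -
    have "tr \<zeta> (f(\<beta> := i)) \<longleftrightarrow> tr \<zeta> f" by (rule tr_cong) (use that in auto)
    then show ?thesis using trD[OF assms(1) that] by simp
  qed
  moreover have "osuc \<beta> \<notin> S" using S_limit osuc_not_limit by blast
  ultimately show ?thesis
    using tr_less[OF assms(1)] assms(2) by (subst tr_iff) (auto simp: less_osuc_iff)
qed

text \<open>Outside \<open>S\<close> only the bound on the values remains, and at
  \<open>\<zeta>\<close> it is read off from \<open>tr (osuc \<zeta>) f\<close>.\<close>

lemma tr_limit:
  assumes "\<beta> \<in> acc UNIV" "\<beta> \<notin> S" "\<And>\<zeta>. \<zeta> < \<beta> \<Longrightarrow> tr \<zeta> f"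
  shows "tr \<beta> f"
  using assms tr_less[OF assms(3)[OF limit_osuc_less] less_osuc] by (subst tr_iff) auto

text \<open>
  The branch is built by recursion along \<open>C \<alpha>\<close> above \<open>\<xi>\<close>. The recursion does not break down at an
  accumulation point of \<open>C \<alpha>\<close>, as this is not in \<open>S\<close>.
\<close>

lemma ex_thread:
  assumes \<alpha>: "\<alpha> \<in> acc UNIV" and \<xi>: "\<xi> < \<alpha>" and x: "tr \<xi> x" and v: "v < omega"
    and IH: "\<And>\<beta> \<zeta> f. \<beta> < \<alpha> \<Longrightarrow> \<zeta> \<le> \<beta> \<Longrightarrow> tr \<zeta> f \<Longrightarrow> \<exists>g. tr \<beta> g \<and> (\<forall>\<eta><\<zeta>. f \<eta> = g \<eta>)"
  shows "\<exists>f. (\<forall>\<eta><\<xi>. f \<eta> = x \<eta>) \<and> (\<forall>\<beta><\<alpha>. tr \<beta> f) \<and> (\<forall>\<zeta>\<in>C \<alpha>. \<xi> \<le> \<zeta> \<longrightarrow> f \<zeta> = v) \<and>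
    (\<forall>\<zeta>\<in>nacc (C \<alpha>). \<xi> < \<zeta> \<longrightarrow> hits \<zeta> f)"
proof -
  \<comment> \<open>One step of the recursion: put \<open>v\<close> at \<open>\<rho>\<close>, then
    extend to level \<open>\<beta>\<close> through the set guessed at \<open>\<beta>\<close>, if
    that guess is \<open>good\<close>.\<close>
  have dense: "\<exists>g. tr \<beta> g \<and> hits \<beta> g \<and> (\<forall>\<eta><\<rho>. f \<eta> = g \<eta>) \<and> g \<rho> = v"
    if f0: "tr \<rho> f" "\<rho> < \<beta>" "\<beta> < \<alpha>" for \<beta> \<rho> f
  proof -
    let ?f = "f(\<rho> := v)"
    have f: "tr (osuc \<rho>) ?f" using tr_osuc[OF f0(1)] v by (simp add: less_max_iff_disj)
    have "\<exists>g. tr \<beta> g \<and> hits \<beta> g \<and> (\<forall>\<eta> < osuc \<rho>. ?f \<eta> = g \<eta>)"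
    proof (cases "good \<beta>")
      case True
      then have "osuc \<rho> < \<beta>" using limit_osuc_less f0(2) by (simp add: good_def)
      then obtain \<eta>' h where h: "\<eta>' < \<beta>" "tr \<eta>' h" "\<phi> (nd \<eta>' h) \<in> A \<beta>"
        "\<forall>\<xi><min (osuc \<rho>) \<eta>'. ?f \<xi> = h \<xi>"
        using True f unfolding good_def by meson
      have "\<exists>g. tr \<beta> g \<and> (\<forall>\<eta> < osuc \<rho>. ?f \<eta> = g \<eta>) \<and> (\<forall>\<eta><\<eta>'. h \<eta> = g \<eta>)"
      \<comment> \<open>The coded node \<open>h\<close> and the node to be extended are comparable,
        so it suffices to extend the longer of the two.\<close>
      proof (cases "osuc \<rho> \<le> \<eta>'")
        case True
        then obtain g where "tr \<beta> g" "\<forall>\<eta><\<eta>'. h \<eta> = g \<eta>"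
          using IH[OF f0(3) less_imp_le[OF h(1)] h(2)] by blast
        then show ?thesis using h(4) True by (intro exI[of _ g]) auto
      next
        case False
        obtain g where "tr \<beta> g" "\<forall>\<eta> < osuc \<rho>. ?f \<eta> = g \<eta>"
          using IH[OF f0(3) less_imp_le[OF \<open>osuc \<rho> < \<beta>\<close>] f] by blast
        then show ?thesis using h(4) False by (intro exI[of _ g]) auto
      qed
      then obtain g where g: "tr \<beta> g" "\<forall>\<eta> < osuc \<rho>. ?f \<eta> = g \<eta>" "\<forall>\<eta><\<eta>'. h \<eta> = g \<eta>" by blast
      have "nd \<eta>' g = nd \<eta>' h" using g(3) by (simp add: nd_eq_iff)
      then have "hits \<beta> g" using h(1,3) by (metis hits_def)
      then show ?thesis using g by blast
    next
      case False
      then show ?thesis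
        using IH[OF f0(3) osuc_le[OF f0(2)] f] by (auto simp: hits_def)
    qed
    then obtain g where g: "tr \<beta> g" "hits \<beta> g" "\<forall>\<eta> < osuc \<rho>. ?f \<eta> = g \<eta>" by blast
    have "f \<eta> = g \<eta>" if "\<eta> < \<rho>" for \<eta>
      using g(3) that less_osuc_iff[of \<eta> \<rho>] by (metis fun_upd_other less_imp_le less_irrefl)
    moreover have "g \<rho> = v" using g(3) less_osuc[of \<rho>] by (metis fun_upd_same)
    ultimately show ?thesis using g by blast
  qed
  \<comment> \<open>\<open>last \<beta>\<close> is the supremum of \<open>\<xi>\<close> and the
    points of \<open>C \<alpha>\<close> up to \<open>\<beta>\<close>; by closedness it is again in
    \<open>insert \<xi> (C \<alpha>)\<close>. \<open>nxt\<close> is the successor within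
    \<open>C \<alpha>\<close>.\<close>
  define last where "last \<beta> = (LEAST \<rho>. \<xi> \<le> \<rho> \<and> (\<forall>\<zeta>\<in>C \<alpha>. \<zeta> \<le> \<beta> \<longrightarrow> \<zeta> \<le> \<rho>))" for \<beta>
  define nxt where "nxt \<rho> = (LEAST \<zeta>. \<zeta> \<in> C \<alpha> \<and> \<rho> < \<zeta>)" for \<rho>
  have nxt: "nxt \<rho> \<in> C \<alpha>" "\<rho> < nxt \<rho>" if "\<rho> < \<alpha>" for \<rho>
    unfolding nxt_def using LeastI_ex[of "\<lambda>\<zeta>. \<zeta> \<in> C \<alpha> \<and> \<rho> < \<zeta>"] C_unbounded[OF \<alpha> that] by blast+
  have last: "\<xi> \<le> last \<beta>" "\<And>\<zeta>. \<zeta> \<in> C \<alpha> \<Longrightarrow> \<zeta> \<le> \<beta> \<Longrightarrow> \<zeta> \<le> last \<beta>" "last \<beta> \<le> \<beta>" if "\<xi> \<le> \<beta>" for \<beta>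
    unfolding last_def
    using LeastI[of "\<lambda>\<rho>. \<xi> \<le> \<rho> \<and> (\<forall>\<zeta>\<in>C \<alpha>. \<zeta> \<le> \<beta> \<longrightarrow> \<zeta> \<le> \<rho>)" \<beta>]
      Least_le[of "\<lambda>\<rho>. \<xi> \<le> \<rho> \<and> (\<forall>\<zeta>\<in>C \<alpha>. \<zeta> \<le> \<beta> \<longrightarrow> \<zeta> \<le> \<rho>)" \<beta>] that by blast+
  have last_in: "last \<beta> \<in> insert \<xi> (C \<alpha>)" if "\<xi> \<le> \<beta>" "\<beta> < \<alpha>" for \<beta>
  proof (rule ccontr)
    assume notin: "last \<beta> \<notin> insert \<xi> (C \<alpha>)"
    then have "\<xi> < last \<beta>" using last(1)[OF that(1)] by auto
    have "\<exists>\<zeta>\<in>C \<alpha>. \<eta> < \<zeta> \<and> \<zeta> < last \<beta>" if "\<eta> < last \<beta>" for \<eta>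
    proof -
      have "max \<xi> \<eta> < last \<beta>" using that \<open>\<xi> < last \<beta>\<close> by simp
      then obtain \<zeta> where \<zeta>: "\<zeta> \<in> C \<alpha>" "\<zeta> \<le> \<beta>" "max \<xi> \<eta> < \<zeta>"
        using not_less_Least[of "max \<xi> \<eta>" "\<lambda>\<rho>. \<xi> \<le> \<rho> \<and> (\<forall>\<zeta>\<in>C \<alpha>. \<zeta> \<le> \<beta> \<longrightarrow> \<zeta> \<le> \<rho>)"]
        unfolding last_def by (meson max.cobounded1 not_le)
      moreover have "\<zeta> \<noteq> last \<beta>" using notin \<zeta>(1) by blast
      ultimately show ?thesis using last(2)[OF \<open>\<xi> \<le> \<beta>\<close>] by force
    qed
    moreover have "last \<beta> < \<alpha>" using last(3)[OF that(1)] that(2) by simp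
    moreover have "ozero < last \<beta>" using \<open>\<xi> < last \<beta>\<close> ozero_less_iff by blast
    ultimately show False using C_closed notin by blast
  qed
  have last_eq: "last \<beta> = \<rho>" if "\<rho> \<in> insert \<xi> (C \<alpha>)" "\<xi> \<le> \<rho>" "\<rho> \<le> \<beta>" "\<beta> < nxt \<rho>" for \<rho> \<beta>
  proof (rule antisym)
    show "last \<beta> \<le> \<rho>"
      unfolding last_def
      by (rule Least_le) (use that(2,4) not_less_Least[of _ "\<lambda>\<zeta>. \<zeta> \<in> C \<alpha> \<and> \<rho> < \<zeta>"] in
        \<open>metis nxt_def not_le order.strict_trans1\<close>)
    show "\<rho> \<le> last \<beta>" using that last[of \<beta>] by auto
  qed
  \<comment> \<open>\<open>ext f \<rho>\<close> is a choice from \<open>dense\<close> that will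
    supply the values on the interval from \<open>\<rho>\<close> up to
    \<open>nxt \<rho>\<close>.\<close>
  define ext where
    "ext f \<rho> = (SOME g. tr (nxt \<rho>) g \<and> hits (nxt \<rho>) g \<and> (\<forall>\<eta><\<rho>. f \<eta> = g \<eta>) \<and> g \<rho> = v)" for f \<rho>
  define f where "f = wfrec {(x, y). x < y} (\<lambda>g \<beta>. if \<beta> < \<xi> then x \<beta> else ext g (last \<beta>) \<beta>)"
  have f_less: "f \<beta> = x \<beta>" if "\<beta> < \<xi>" for \<beta>
    unfolding f_def using that by (subst wfrec[OF wf]) simp
  have f_ext: "f \<beta> = ext f (last \<beta>) \<beta>" if "\<xi> \<le> \<beta>" for \<beta>
  proof -
    let ?c = "cut f {(x, y). x < y} \<beta>"
    \<comment> \<open>Cutting \<open>f\<close> at \<open>\<beta>\<close> does no harm, as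
      \<open>ext\<close> consults \<open>f\<close> only below
      \<open>last \<beta> \<le> \<beta>\<close>.\<close>
    have "(\<forall>\<eta><last \<beta>. ?c \<eta> = g \<eta>) \<longleftrightarrow> (\<forall>\<eta><last \<beta>. f \<eta> = g \<eta>)" for g
      using last(3)[OF that] by (auto simp: cut_apply)
    then have "ext ?c (last \<beta>) = ext f (last \<beta>)" unfolding ext_def by simp
    moreover have "f \<beta> = ext ?c (last \<beta>) \<beta>"
      unfolding f_def using that by (subst wfrec[OF wf]) (simp add: leD)
    ultimately show ?thesis by simp
  qed
  have step: "tr (nxt \<rho>) f \<and> hits (nxt \<rho>) f \<and> f \<rho> = v"
    if \<rho>: "\<rho> \<in> insert \<xi> (C \<alpha>)" "\<xi> \<le> \<rho>" "tr \<rho> f" for \<rho>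
  proof -
    have "\<rho> < \<alpha>" using \<rho>(1) \<xi> C_less by auto
    have e: "tr (nxt \<rho>) (ext f \<rho>)" "hits (nxt \<rho>) (ext f \<rho>)" "\<forall>\<eta><\<rho>. f \<eta> = ext f \<rho> \<eta>" "ext f \<rho> \<rho> = v"
      using someI_ex[OF dense[OF \<rho>(3) nxt(2)[OF \<open>\<rho> < \<alpha>\<close>] C_less[OF nxt(1)[OF \<open>\<rho> < \<alpha>\<close>]]]]
      unfolding ext_def by blast+
    \<comment> \<open>On the interval from \<open>\<rho>\<close> up to \<open>nxt \<rho>\<close> the
      value of \<open>last\<close> is constantly \<open>\<rho>\<close>, so a single choice is used
      throughout.\<close>
    have agree: "f \<eta> = ext f \<rho> \<eta>" if "\<eta> < nxt \<rho>" for \<eta>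
    proof (cases "\<eta> < \<rho>")
      case False
      then show ?thesis using f_ext[of \<eta>] last_eq[OF \<rho>(1,2) _ that] \<rho>(2) by simp
    qed (use e(3) in blast)
    then have "tr (nxt \<rho>) f" "hits (nxt \<rho>) f"
      using e tr_cong[of "nxt \<rho>" f "ext f \<rho>"] hits_cong[of "nxt \<rho>" f "ext f \<rho>"] by auto
    then show ?thesis using agree[OF nxt(2)[OF \<open>\<rho> < \<alpha>\<close>]] e(4) by simp
  qed
  have nxt_last: "nxt (last \<eta>) = \<beta>"
    if "\<xi> \<le> \<eta>" "\<eta> < \<beta>" "\<beta> \<in> C \<alpha>" "\<And>\<zeta>. \<zeta> \<in> C \<alpha> \<Longrightarrow> \<eta> < \<zeta> \<Longrightarrow> \<beta> \<le> \<zeta>" for \<eta> \<beta>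
    unfolding nxt_def
  proof (rule Least_equality)
    show "\<beta> \<in> C \<alpha> \<and> last \<eta> < \<beta>" using that(2,3) last(3)[OF that(1)] by auto
    show "\<beta> \<le> \<zeta>" if "\<zeta> \<in> C \<alpha> \<and> last \<eta> < \<zeta>" for \<zeta>
      using that last(2)[OF \<open>\<xi> \<le> \<eta>\<close>] \<open>\<And>\<zeta>. \<zeta> \<in> C \<alpha> \<Longrightarrow> \<eta> < \<zeta> \<Longrightarrow> \<beta> \<le> \<zeta>\<close> by (meson leD not_le)
  qed
  \<comment> \<open>A non-accumulation point of \<open>C \<alpha>\<close> above \<open>\<xi>\<close>
    is reached by \<open>nxt\<close> from an earlier stage, so \<open>step\<close> applies to
    it.\<close>
  have ex_last: "\<exists>\<rho>. \<rho> \<in> insert \<xi> (C \<alpha>) \<and> \<xi> \<le> \<rho> \<and> \<rho> < \<beta> \<and> nxt \<rho> = \<beta>"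
    if \<beta>: "\<beta> \<in> C \<alpha>" "\<xi> < \<beta>" "\<beta> \<notin> acc (C \<alpha>)" for \<beta>
  proof -
    have "ozero < \<beta>" using \<beta>(2) ozero_less_iff by blast
    then obtain \<eta> where \<eta>: "\<eta> < \<beta>" "\<And>\<zeta>. \<zeta> \<in> C \<alpha> \<Longrightarrow> \<eta> < \<zeta> \<Longrightarrow> \<beta> \<le> \<zeta>"
      using \<beta> unfolding acc_iff by (meson not_less)
    let ?\<eta> = "max \<xi> \<eta>"
    have "nxt (last ?\<eta>) = \<beta>" by (rule nxt_last) (use \<beta> \<eta> in auto)
    moreover have "?\<eta> < \<alpha>" "?\<eta> < \<beta>" using \<eta>(1) \<beta>(2) \<xi> C_less[OF \<beta>(1)] by auto
    moreover have "last ?\<eta> < \<beta>"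
      using last(3)[OF max.cobounded1] \<open>?\<eta> < \<beta>\<close> by (rule order.strict_trans1)
    ultimately show ?thesis
      using last(1)[of ?\<eta>] last_in[of ?\<eta>] by (intro exI[of _ "last ?\<eta>"]) simp
  qed
  have tr_C: "tr \<beta> f" if "\<beta> \<in> insert \<xi> (C \<alpha>)" "\<xi> \<le> \<beta>" for \<beta>
    using that
  proof (induction \<beta> rule: less_induct)
    case (less \<beta>)
    consider "\<beta> = \<xi>" | "\<beta> \<in> acc (C \<alpha>)" "\<xi> < \<beta>" | "\<beta> \<in> C \<alpha>" "\<beta> \<notin> acc (C \<alpha>)" "\<xi> < \<beta>"
      using less.prems by fastforce
    then show ?case
    proof cases
      case 1
      then show ?thesis using x f_less tr_cong[of \<xi> f x] by simp
    next
      case 2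
      have "tr \<zeta> f" if "\<zeta> < \<beta>" for \<zeta>
      proof -
        have "max \<xi> \<zeta> < \<beta>" using that 2 by simp
        then obtain \<eta> where "\<eta> \<in> C \<alpha>" "max \<xi> \<zeta> < \<eta>" "\<eta> < \<beta>"
          using 2(1) unfolding acc_iff by blast
        then show ?thesis using less.IH[of \<eta>] trD[of \<eta> f \<zeta>] by auto
      qed
      moreover have "\<beta> \<in> acc UNIV" using 2(1) by (auto simp: acc_iff)
      ultimately show ?thesis using tr_limit acc_C_notin_S[OF 2(1)] by blast
    next
      case 3
      then obtain \<rho> where "\<rho> \<in> insert \<xi> (C \<alpha>)" "\<xi> \<le> \<rho>" "\<rho> < \<beta>" "nxt \<rho> = \<beta>" using ex_last by blast
      then show ?thesis using less.IH[of \<rho>] step[of \<rho>] by auto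
    qed
  qed
  have "tr \<beta> f" if "\<beta> < \<alpha>" for \<beta>
  proof -
    obtain \<zeta> where "\<zeta> \<in> C \<alpha>" "max \<xi> \<beta> < \<zeta>"
      using C_unbounded[OF \<alpha>, of "max \<xi> \<beta>"] \<open>\<beta> < \<alpha>\<close> \<xi> by auto
    then show ?thesis using tr_C[of \<zeta>] trD[of \<zeta> f \<beta>] by auto
  qed
  moreover have "hits \<zeta> f" if \<zeta>: "\<zeta> \<in> nacc (C \<alpha>)" "\<xi> < \<zeta>" for \<zeta>
  proof -
    obtain \<rho> where "\<rho> \<in> insert \<xi> (C \<alpha>)" "\<xi> \<le> \<rho>" "nxt \<rho> = \<zeta>"
      using ex_last[of \<zeta>] \<zeta> by (auto simp: nacc_def)
    then show ?thesis using step[of \<rho>] tr_C[of \<rho>] by blast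
  qed
  ultimately show ?thesis using f_less step tr_C by blast
qed

text \<open>At limits, \<open>ex_thread\<close> with value \<open>ozero\<close> yields exactly the
  clause required at levels in \<open>S\<close>, with threshold \<open>\<gamma> = \<zeta>\<close>;
  the induction hypothesis feeds its extension assumption.\<close>

lemma tr_extend: "\<zeta> \<le> \<beta> \<Longrightarrow> tr \<zeta> f \<Longrightarrow> \<exists>g. tr \<beta> g \<and> (\<forall>\<eta><\<zeta>. f \<eta> = g \<eta>)"
proof (induction \<beta> arbitrary: \<zeta> f rule: less_induct)
  case (less \<beta>)
  show ?case
  proof (cases "\<zeta> = \<beta>")
    case False
    then have "\<zeta> < \<beta>" using less.prems by simp
    show ?thesis
    proof (cases \<beta> rule: ordinal_cases)
      case 1
      then show ?thesis using \<open>\<zeta> < \<beta>\<close> ozero_le leD by blast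
    next
      case (2 \<gamma>)
      then have "\<gamma> < \<beta>" "\<zeta> \<le> \<gamma>" using \<open>\<zeta> < \<beta>\<close> less_osuc less_osuc_iff by auto
      then obtain g where g: "tr \<gamma> g" "\<forall>\<eta><\<zeta>. f \<eta> = g \<eta>" using less by blast
      have "tr \<beta> (g(\<gamma> := ozero))"
        unfolding 2 using tr_osuc[OF g(1)] ozero_less_omega by (simp add: less_max_iff_disj)
      moreover have "\<forall>\<eta><\<zeta>. f \<eta> = (g(\<gamma> := ozero)) \<eta>" using g(2) \<open>\<zeta> \<le> \<gamma>\<close> by auto
      ultimately show ?thesis by blast
    next
      case 3
      obtain g where g: "\<forall>\<eta><\<zeta>. g \<eta> = f \<eta>" "\<forall>\<eta><\<beta>. tr \<eta> g" "\<forall>\<eta>\<in>C \<beta>. \<zeta> \<le> \<eta> \<longrightarrow> g \<eta> = ozero"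
        "\<forall>\<eta>\<in>nacc (C \<beta>). \<zeta> < \<eta> \<longrightarrow> hits \<eta> g"
        using ex_thread[OF 3 \<open>\<zeta> < \<beta>\<close> less.prems(2) ozero_less_omega] less.IH by blast
      have "g \<eta> < max omega \<eta>" if "\<eta> < \<beta>" for \<eta>
        using g(2) limit_osuc_less[OF 3 that] tr_less less_osuc by blast
      then have "tr \<beta> g" using g(2-) \<open>\<zeta> < \<beta>\<close> by (subst tr_iff) (auto intro!: exI[of _ \<zeta>])
      then show ?thesis using g(1) by auto
    qed
  qed (use less.prems in blast)
qed

end

section \<open>The tree as a set of nodes, and its branches\<close>

context tree_construction
begin

definition Tree :: "'k node set"
  where "Tree = {nd \<beta> f | \<beta> f. tr \<beta> f}"

lemma TreeE:
  assumes "t \<in> Tree"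
  obtains \<beta> f where "t = nd \<beta> f" "tr \<beta> f"
  using assms unfolding Tree_def by blast

lemma nd_in_Tree_iff: "nd \<beta> f \<in> Tree \<longleftrightarrow> tr \<beta> f"
proof
  assume "nd \<beta> f \<in> Tree"
  then obtain \<gamma> g where "nd \<beta> f = nd \<gamma> g" "tr \<gamma> g" by (rule TreeE)
  then show "tr \<beta> f" using tr_cong[of \<beta> f g] by (auto simp: nd_eq_iff)
qed (auto simp: Tree_def)

lemma level_Tree: "level Tree \<beta> = {nd \<beta> f | f. tr \<beta> f}"
proof
  show "level Tree \<beta> \<subseteq> {nd \<beta> f | f. tr \<beta> f}"
  proof
    fix t assume t: "t \<in> level Tree \<beta>"
    then obtain \<gamma> f where f: "t = nd \<gamma> f" "tr \<gamma> f" by (auto simp: level_def elim: TreeE)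
    then have "{..<\<gamma>} = {..<\<beta>}" using t by (simp add: level_def funs_def)
    then show "t \<in> {nd \<beta> f | f. tr \<beta> f}" using f by auto
  qed
  show "{nd \<beta> f | f. tr \<beta> f} \<subseteq> level Tree \<beta>"
    using nd_in_funs by (auto simp: level_def nd_in_Tree_iff)
qed

lemma level_Tree_subset: "level Tree \<beta> \<subseteq> bounded_nodes \<beta>"
  using tr_less by (auto simp: level_Tree bounded_nodes_def)

lemma card_level_Tree: "|level Tree \<beta>| <o (kappa :: 'k rel)"
  using ordLeq_ordLess_trans[OF card_of_mono1[OF level_Tree_subset] card_bounded_nodes] .

lemma streamlined_Tree: "streamlined_tree Tree"
proof -
  have "t \<in> (\<Union>\<alpha>. funs \<alpha>)" if "t \<in> Tree" for t
    using that nd_in_funs by (auto elim!: TreeE)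
  moreover have "t |` {..<\<alpha>} \<in> Tree" if "t \<in> Tree" for t \<alpha>
    using that by (auto elim!: TreeE simp: nd_restrict nd_in_Tree_iff intro!: trD[OF _ min.cobounded2])
  moreover have "level Tree \<alpha> \<noteq> {}" for \<alpha>
    using tr_extend[OF ozero_le tr_ozero] unfolding level_Tree by blast
  ultimately show ?thesis using card_level_Tree by (auto simp: streamlined_tree_def)
qed

lemma normal_Tree: "normal_tree Tree"
  unfolding normal_tree_def
proof (intro allI impI ballI)
  fix \<alpha> \<beta> :: 'k and s assume "\<alpha> < \<beta>" "s \<in> level Tree \<alpha>"
  then obtain f where f: "s = nd \<alpha> f" "tr \<alpha> f" by (auto simp: level_Tree)
  then obtain g where "tr \<beta> g" "\<forall>\<eta><\<alpha>. f \<eta> = g \<eta>"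
    using tr_extend[OF less_imp_le[OF \<open>\<alpha> < \<beta>\<close>]] by blast
  then have "nd \<beta> g \<in> level Tree \<beta>" "node_less s (nd \<beta> g)"
    using \<open>\<alpha> < \<beta>\<close> f by (auto simp: level_Tree node_less_nd_iff)
  then show "\<exists>t\<in>level Tree \<beta>. node_less s t" by blast
qed

lemma prolific_Tree: "prolific Tree"
  unfolding prolific_def
proof (intro allI impI ballI)
  fix \<alpha> i :: 'k and t assume "t \<in> level Tree \<alpha>" "i < max omega \<alpha>"
  then obtain f where f: "t = nd \<alpha> f" "tr (osuc \<alpha>) (f(\<alpha> := i))"
    using tr_osuc by (auto simp: level_Tree)
  have "t(\<alpha> \<mapsto> hord i) = nd (osuc \<alpha>) (f(\<alpha> := i))"
    by (rule ext) (auto simp: f(1) nd_def less_osuc_iff)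
  then show "t(\<alpha> \<mapsto> hord i) \<in> Tree" using f(2) by (simp add: nd_in_Tree_iff)
qed

lemma height_nd: "tr \<beta> f \<Longrightarrow> height Tree (nd \<beta> f) = \<beta>"
  by (rule height_streamlined[OF streamlined_Tree]) (auto simp: level_Tree)

lemma branch_nd_image:
  assumes "\<And>\<beta>. \<beta> \<in> X \<Longrightarrow> tr \<beta> f"
  shows "branch Tree X ((\<lambda>\<beta>. nd \<beta> f) ` X)"
  unfolding branch_def
proof (intro conjI)
  show "(\<lambda>\<beta>. nd \<beta> f) ` X \<subseteq> Tree" using assms by (auto simp: nd_in_Tree_iff)
  show "height Tree ` (\<lambda>\<beta>. nd \<beta> f) ` X = X" using assms by (simp add: image_image height_nd)
  show "\<forall>s\<in>(\<lambda>\<beta>. nd \<beta> f) ` X. \<forall>t\<in>(\<lambda>\<beta>. nd \<beta> f) ` X. s = t \<or> node_less s t \<or> node_less t s"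
    using linorder_less_linear by (auto simp: node_less_nd_iff nd_eq_iff)
qed

text \<open>Comparable nodes glue to one function. Downward closure of \<open>X\<close> covers both
  \<open>{..<\<alpha>}\<close> and \<open>UNIV\<close>.\<close>

lemma branch_TreeE:
  assumes B: "branch Tree X B" and X: "\<And>\<zeta> \<beta>. \<beta> \<in> X \<Longrightarrow> \<zeta> \<le> \<beta> \<Longrightarrow> \<zeta> \<in> X"
  obtains f where "\<And>\<beta>. \<beta> \<in> X \<Longrightarrow> tr \<beta> f" "B = (\<lambda>\<beta>. nd \<beta> f) ` X"
proof -
  have "\<exists>g. nd \<beta> g \<in> B \<and> tr \<beta> g" if "\<beta> \<in> X" for \<beta>
  proof -
    obtain t where t: "t \<in> B" "height Tree t = \<beta>" using \<open>\<beta> \<in> X\<close> B unfolding branch_def by blast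
    then obtain \<gamma> g where "t = nd \<gamma> g" "tr \<gamma> g" using B TreeE unfolding branch_def by (metis subsetD)
    then show ?thesis using t height_nd[of \<gamma> g] by auto
  qed
  then obtain F where F: "\<And>\<beta>. \<beta> \<in> X \<Longrightarrow> nd \<beta> (F \<beta>) \<in> B" "\<And>\<beta>. \<beta> \<in> X \<Longrightarrow> tr \<beta> (F \<beta>)" by metis
  have agree: "g \<zeta> = h \<zeta>"
    if "nd \<beta> g \<in> B" "nd \<gamma> h \<in> B" "\<zeta> < \<beta>" "\<zeta> < \<gamma>" for \<beta> \<gamma> \<zeta> g h
  proof -
    have "nd \<beta> g = nd \<gamma> h \<or> node_less (nd \<beta> g) (nd \<gamma> h) \<or> node_less (nd \<gamma> h) (nd \<beta> g)"
      using B that(1,2) unfolding branch_def by blast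
    then show ?thesis using that(3,4) by (auto simp: nd_eq_iff node_less_nd_iff)
  qed
  \<comment> \<open>Members of \<open>B\<close> agree on common domains, so the value at
    \<open>\<zeta>\<close> can be taken from level \<open>osuc \<zeta>\<close>, the first whose
    nodes are defined at \<open>\<zeta>\<close>.\<close>
  define f where "f \<zeta> = F (osuc \<zeta>) \<zeta>" for \<zeta>
  have f_eq: "f \<zeta> = F \<beta> \<zeta>" if "\<beta> \<in> X" "\<zeta> < \<beta>" for \<beta> \<zeta>
    unfolding f_def using agree[OF F(1) F(1)] X[OF that(1) osuc_le[OF that(2)]] that less_osuc by blast
  then have nd_eq: "nd \<beta> f = nd \<beta> (F \<beta>)" if "\<beta> \<in> X" for \<beta> using that by (simp add: nd_eq_iff)
  show thesis
  proof
    show "tr \<beta> f" if "\<beta> \<in> X" for \<beta>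
      using F(2)[OF that] nd_eq[OF that] nd_in_Tree_iff by metis
    show "B = (\<lambda>\<beta>. nd \<beta> f) ` X"
    proof
      show "(\<lambda>\<beta>. nd \<beta> f) ` X \<subseteq> B" using F(1) nd_eq by auto
      show "B \<subseteq> (\<lambda>\<beta>. nd \<beta> f) ` X"
      proof
        fix t assume t: "t \<in> B"
        then have "t \<in> Tree" using B unfolding branch_def by blast
        then obtain \<gamma> g where g: "t = nd \<gamma> g" "tr \<gamma> g" by (rule TreeE)
        have "height Tree t \<in> X" using B t unfolding branch_def by blast
        then have \<gamma>: "\<gamma> \<in> X" using g height_nd by simp
        have "g \<zeta> = F \<gamma> \<zeta>" if "\<zeta> < \<gamma>" for \<zeta> using agree t F(1)[OF \<gamma>] that unfolding g(1) by blast
        then have "t = nd \<gamma> f" unfolding nd_eq[OF \<gamma>] g(1) by (simp add: nd_eq_iff)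
        then show "t \<in> (\<lambda>\<beta>. nd \<beta> f) ` X" using \<gamma> by blast
      qed
    qed
  qed
qed

section \<open>The levels with vanishing branches\<close>

text \<open>A thread with a nonzero value \<open>v\<close> along \<open>C \<alpha>\<close> has no
  upper bound, because every node of level \<open>\<alpha>\<close> is eventually
  \<open>ozero\<close> on \<open>C \<alpha>\<close>.\<close>

lemma ex_vanishing_branch:
  assumes \<alpha>: "\<alpha> \<in> S" and \<xi>: "\<xi> < \<alpha>" and x: "tr \<xi> x"
  shows "\<exists>B. branch Tree {..<\<alpha>} B \<and> vanishing Tree B \<and> nd \<xi> x \<in> B"
proof -
  obtain v :: 'k where v: "v < omega" "v \<noteq> ozero" using ex_nonzero_less_omega by blast
  have lim: "\<alpha> \<in> acc UNIV" using \<alpha> S_limit by blast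
  obtain f where f: "\<forall>\<eta><\<xi>. f \<eta> = x \<eta>" "\<forall>\<beta><\<alpha>. tr \<beta> f" "\<forall>\<zeta>\<in>C \<alpha>. \<xi> \<le> \<zeta> \<longrightarrow> f \<zeta> = v"
    using ex_thread[OF lim \<xi> x v(1)] tr_extend by blast
  let ?B = "(\<lambda>\<beta>. nd \<beta> f) ` {..<\<alpha>}"
  have "branch Tree {..<\<alpha>} ?B" using f(2) by (intro branch_nd_image) auto
  moreover have "vanishing Tree ?B"
    unfolding vanishing_def
  proof
    assume "\<exists>t. t \<in> Tree \<and> (\<forall>s\<in>?B. s = t \<or> node_less s t)"
    then obtain t where t: "t \<in> Tree" "\<And>\<beta>. \<beta> < \<alpha> \<Longrightarrow> nd \<beta> f \<subseteq>\<^sub>m t"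
      unfolding node_less_def by (metis image_eqI lessThan_iff map_le_refl)
    then obtain \<delta> g where g: "tr \<delta> g" "\<And>\<beta>. \<beta> < \<alpha> \<Longrightarrow> nd \<beta> f \<subseteq>\<^sub>m nd \<delta> g" by (metis TreeE)
    \<comment> \<open>An upper bound at a level \<open>\<delta> < \<alpha>\<close> would have to
      extend the branch node of level \<open>osuc \<delta>\<close>.\<close>
    have "\<alpha> \<le> \<delta>"
    proof (rule ccontr)
      assume "\<not> \<alpha> \<le> \<delta>"
      then have "osuc \<delta> \<le> \<delta>" using g(2)[OF limit_osuc_less[OF lim, of \<delta>]] by (simp add: nd_le_iff)
      then show False using less_osuc[of \<delta>] by simp
    qed
    then obtain \<gamma> where \<gamma>: "\<gamma> < \<alpha>" "\<forall>\<zeta>\<in>C \<alpha>. \<gamma> < \<zeta> \<longrightarrow> g \<zeta> = ozero"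
      using tr_S[OF trD[OF g(1)] \<alpha>] by blast
    \<comment> \<open>Past both thresholds, \<open>f\<close> takes the value \<open>v\<close> and
      \<open>g\<close> the value \<open>ozero\<close>, although \<open>g\<close> extends the
      branch.\<close>
    obtain \<zeta> where \<zeta>: "\<zeta> \<in> C \<alpha>" "max \<xi> \<gamma> < \<zeta>" using C_unbounded[OF lim, of "max \<xi> \<gamma>"] \<xi> \<gamma>(1) by auto
    have "f \<zeta> = g \<zeta>"
      using g(2)[OF limit_osuc_less[OF lim C_less[OF \<zeta>(1)]]] less_osuc by (simp add: nd_le_iff)
    then show False using \<gamma>(2) f(3) \<zeta> v(2) by auto
  qed
  moreover have "nd \<xi> x = nd \<xi> f" using f(1) by (simp add: nd_eq_iff)
  ultimately show ?thesis using \<xi> by blast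
qed

lemma S_subset_V: "S \<subseteq> V Tree"
proof
  fix \<alpha> assume \<alpha>: "\<alpha> \<in> S"
  have "\<exists>B. branch Tree {..<\<alpha>} B \<and> vanishing Tree B \<and> t \<in> B"
    if "t \<in> Tree" "height Tree t < \<alpha>" for t
    using that(1)
  proof (rule TreeE)
    fix \<beta> f assume f: "t = nd \<beta> f" "tr \<beta> f"
    then show ?thesis using ex_vanishing_branch[OF \<alpha> _ f(2)] that(2) height_nd by simp
  qed
  then show "\<alpha> \<in> V Tree" using \<alpha> S_limit by (auto simp: V_def)
qed

text \<open>The root has height \<open>ozero < \<alpha>\<close>, so some vanishing branch passes
  through it.\<close>

lemma V_subset_V_minus: "V Tree \<subseteq> V_minus Tree"
proof
  fix \<alpha> assume \<alpha>: "\<alpha> \<in> V Tree"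
  then have "ozero < \<alpha>" by (simp add: V_def acc_iff)
  moreover have "nd ozero f \<in> Tree" "height Tree (nd ozero f) = ozero" for f
    using tr_ozero by (auto simp: nd_in_Tree_iff height_nd)
  ultimately show "\<alpha> \<in> V_minus Tree" using \<alpha> unfolding V_def V_minus_def by fastforce
qed

text \<open>At a limit outside \<open>S\<close>, the union of any branch is a node of the
  tree.\<close>

lemma V_minus_subset_S: "V_minus Tree \<subseteq> S"
proof (rule subsetI, rule ccontr)
  fix \<alpha> assume "\<alpha> \<in> V_minus Tree" and \<alpha>: "\<alpha> \<notin> S"
  then obtain B where lim: "\<alpha> \<in> acc UNIV" and B: "branch Tree {..<\<alpha>} B" "vanishing Tree B"
    by (auto simp: V_minus_def)
  obtain f where f: "\<And>\<beta>. \<beta> \<in> {..<\<alpha>} \<Longrightarrow> tr \<beta> f" "B = (\<lambda>\<beta>. nd \<beta> f) ` {..<\<alpha>}"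
    using branch_TreeE[OF B(1)] by (metis lessThan_iff order.strict_trans1)
  have "nd \<alpha> f \<in> Tree" using tr_limit[OF lim \<alpha>] f(1) by (simp add: nd_in_Tree_iff)
  moreover have "\<forall>s\<in>B. node_less s (nd \<alpha> f)" by (auto simp: f(2) node_less_nd_iff)
  ultimately show False using B(2) unfolding vanishing_def by blast
qed

section \<open>Antichains and the Souslin property\<close>

text \<open>
  A maximal antichain \<open>M\<close> is guessed on a cofinal set of levels, hence at cofinally many points of
  \<open>nacc (C \<alpha>)\<close> for some \<open>\<alpha> \<in> S\<close>, so every node of level \<open>\<alpha>\<close> extends a member of \<open>M\<close>.
\<close>

lemma maximal_antichain_small:
  assumes M: "antichain Tree M" and max: "\<And>t. t \<in> Tree \<Longrightarrow> \<exists>a\<in>M. a \<subseteq>\<^sub>m t \<or> t \<subseteq>\<^sub>m a"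
  shows "|M| <o (kappa :: 'k rel)"
proof -
  have MT: "M \<subseteq> Tree" using M by (simp add: antichain_def)
  have "\<exists>\<eta> h. tr \<eta> h \<and> nd \<eta> h \<in> M \<and> (nd \<eta> h \<subseteq>\<^sub>m t \<or> t \<subseteq>\<^sub>m nd \<eta> h)" if "t \<in> Tree" for t
  proof -
    obtain a where "a \<in> M" "a \<subseteq>\<^sub>m t \<or> t \<subseteq>\<^sub>m a" using max[OF \<open>t \<in> Tree\<close>] by blast
    moreover obtain \<eta> h where "a = nd \<eta> h" "tr \<eta> h" using \<open>a \<in> M\<close> MT TreeE by blast
    ultimately show ?thesis by blast
  qed
  then obtain l where l: "\<And>t. t \<in> Tree \<Longrightarrow>
      \<exists>h. tr (l t) h \<and> nd (l t) h \<in> M \<and> (nd (l t) h \<subseteq>\<^sub>m t \<or> t \<subseteq>\<^sub>m nd (l t) h)"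
    by metis
  have "\<exists>\<delta>. \<forall>t\<in>level Tree \<beta>. max (\<phi> t) (l t) < \<delta>" for \<beta>
    by (rule bounded_image[OF card_level_Tree])
  \<comment> \<open>Levels are small, so the codes of the nodes in a level and the levels
    \<open>l t\<close> of their comparable members of \<open>M\<close> are bounded together.\<close>
  then obtain G where G: "\<And>\<beta> t. t \<in> level Tree \<beta> \<Longrightarrow> max (\<phi> t) (l t) < G \<beta>" by metis
  \<comment> \<open>At a level in \<open>B\<close>, hitting the guess means passing through
    \<open>M\<close>.\<close>
  define B where "B = {\<delta>. good \<delta> \<and> (\<forall>f \<eta>. tr \<eta> f \<longrightarrow> \<phi> (nd \<eta> f) \<in> A \<delta> \<longrightarrow> nd \<eta> f \<in> M)}"
  have "\<exists>\<delta>\<in>B. \<alpha> < \<delta>" for \<alpha>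
  proof -
    \<comment> \<open>Closure under \<open>?g\<close> puts \<open>\<delta>\<close> above
      \<open>\<alpha>\<close>, makes it a limit, and reflects the maximality of \<open>M\<close>
      below \<open>\<delta>\<close>.\<close>
    let ?g = "\<lambda>\<beta>. max \<alpha> (max (G \<beta>) (osuc \<beta>))"
    have "stationary {\<delta>. (\<phi> ` M) \<inter> {..<\<delta>} = A \<delta>}"
      using diamond unfolding diamond_sequence_def by blast
    then obtain \<delta> where A: "(\<phi> ` M) \<inter> {..<\<delta>} = A \<delta>"
      and \<delta>: "ozero < \<delta>" "\<And>\<beta>. \<beta> < \<delta> \<Longrightarrow> ?g \<beta> < \<delta>"
      unfolding stationary_def using closure_points_club[of ?g] by blast
    have "\<delta> \<in> acc UNIV"
      using \<delta> less_osuc unfolding acc_UNIV_iff by (meson max_less_iff_conj)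
    moreover have "\<exists>\<eta>'<\<delta>. \<exists>h. tr \<eta>' h \<and> \<phi> (nd \<eta>' h) \<in> A \<delta> \<and> (\<forall>\<xi><min \<eta> \<eta>'. g \<xi> = h \<xi>)"
      if \<eta>: "\<eta> < \<delta>" and g: "tr \<eta> g" for \<eta> g
    proof -
      let ?t = "nd \<eta> g"
      have t: "?t \<in> level Tree \<eta>" "?t \<in> Tree" using g by (auto simp: level_Tree nd_in_Tree_iff)
      obtain h where h: "tr (l ?t) h" "nd (l ?t) h \<in> M" "nd (l ?t) h \<subseteq>\<^sub>m ?t \<or> ?t \<subseteq>\<^sub>m nd (l ?t) h"
        using l[OF t(2)] by blast
      have "l ?t < \<delta>" using G[OF t(1)] \<delta>(2)[OF \<eta>] by auto
      moreover have "nd (l ?t) h \<in> level Tree (l ?t)" using h(1) by (auto simp: level_Tree)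
      \<comment> \<open>\<open>G\<close> is applied a second time, now at level \<open>l ?t\<close>,
        to bound the code of the comparable member.\<close>
      ultimately have "\<phi> (nd (l ?t) h) < \<delta>" using G \<delta>(2) by (meson less_trans max_less_iff_conj)
      then have "\<phi> (nd (l ?t) h) \<in> A \<delta>" using h(2) A by blast
      moreover have "\<forall>\<xi><min \<eta> (l ?t). g \<xi> = h \<xi>" using h(3) by (auto simp: nd_le_iff)
      ultimately show ?thesis using \<open>l ?t < \<delta>\<close> h(1) by blast
    qed
    ultimately have "good \<delta>" unfolding good_def by blast
    moreover have "nd \<eta> f \<in> M" if f: "tr \<eta> f" "\<phi> (nd \<eta> f) \<in> A \<delta>" for \<eta> f
    proof -
      obtain a where a: "a \<in> M" "\<phi> (nd \<eta> f) = \<phi> a" using f(2) A by blast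
      have "t \<in> (\<Union>\<beta>. bounded_nodes \<beta>)" if "t \<in> Tree" for t
        using that level_Tree_subset by (fastforce elim!: TreeE simp: level_Tree)
      then have "nd \<eta> f \<in> (\<Union>\<beta>. bounded_nodes \<beta>)" "a \<in> (\<Union>\<beta>. bounded_nodes \<beta>)"
        using f(1) a(1) MT nd_in_Tree_iff by blast+
      then have "nd \<eta> f = a" using a(2) inj_on_eq_iff[OF \<phi>_inj] by blast
      then show ?thesis using a(1) by simp
    qed
    ultimately have "\<delta> \<in> B" by (auto simp: B_def)
    then show ?thesis using \<delta>(2)[OF \<delta>(1)] by auto
  qed
  then have "cofinal B kappa" by (simp add: cofinal_kappa_iff)
  then obtain \<alpha> where \<alpha>: "\<alpha> \<in> S" "\<And>\<xi>. \<xi> < \<alpha> \<Longrightarrow> \<exists>\<zeta>\<in>nacc (C \<alpha>) \<inter> B. \<xi> < \<zeta>"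
    using guess by blast
  \<comment> \<open>Past the threshold \<open>\<gamma>\<close> there is still a point of
    \<open>nacc (C \<alpha>)\<close> in \<open>B\<close>, and hitting the guess there puts an
    initial segment of \<open>f\<close> into \<open>M\<close>.\<close>
  have seal: "\<exists>\<eta><\<alpha>. nd \<eta> f \<in> M" if f: "tr \<alpha> f" for f
  proof -
    obtain \<gamma> where \<gamma>: "\<gamma> < \<alpha>" "\<forall>\<zeta>\<in>nacc (C \<alpha>). \<gamma> < \<zeta> \<longrightarrow> hits \<zeta> f"
      using tr_S[OF f \<alpha>(1)] by blast
    obtain \<zeta> where \<zeta>: "\<zeta> \<in> nacc (C \<alpha>)" "\<zeta> \<in> B" "\<gamma> < \<zeta>" using \<alpha>(2)[OF \<gamma>(1)] by blast
    obtain \<eta> where \<eta>: "\<eta> < \<zeta>" "\<phi> (nd \<eta> f) \<in> A \<zeta>"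
      using \<gamma>(2) \<zeta> unfolding hits_def B_def by blast
    have "\<zeta> < \<alpha>" using \<zeta>(1) C_less[of \<zeta> \<alpha>] by (simp add: nacc_def)
    then have "\<eta> < \<alpha>" using \<eta>(1) by simp
    moreover from this have "tr \<eta> f" using trD[OF f] by simp
    then have "nd \<eta> f \<in> M" using \<zeta>(2) \<eta>(2) by (simp add: B_def)
    ultimately show ?thesis by blast
  qed
  have "M \<subseteq> (\<Union>\<beta>\<in>{..<\<alpha>}. level Tree \<beta>)"
  proof
    fix a assume a: "a \<in> M"
    then obtain \<beta> f where f: "a = nd \<beta> f" "tr \<beta> f" using MT TreeE by blast
    \<comment> \<open>A member of \<open>M\<close> at level \<open>\<alpha>\<close> or above would
      properly extend the member found by \<open>seal\<close>.\<close>
    have "\<beta> < \<alpha>"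
    proof (rule ccontr)
      assume "\<not> \<beta> < \<alpha>"
      then have "\<alpha> \<le> \<beta>" by simp
      then obtain \<eta> where "\<eta> < \<alpha>" "nd \<eta> f \<in> M" using seal[OF trD[OF f(2)]] by blast
      moreover from this have "node_less (nd \<eta> f) a"
        using \<open>\<alpha> \<le> \<beta>\<close> by (simp add: f(1) node_less_nd_iff)
      ultimately show False using M a unfolding antichain_def node_less_def by blast
    qed
    then show "a \<in> (\<Union>\<beta>\<in>{..<\<alpha>}. level Tree \<beta>)" using f by (auto simp: level_Tree)
  qed
  moreover have "|\<Union>\<beta>\<in>{..<\<alpha>}. level Tree \<beta>| <o (kappa :: 'k rel)"
    by (rule stable_UNION[OF stable_kappa card_lessThan_kappa[OF Card_order_kappa] card_level_Tree])
  ultimately show ?thesis using card_of_mono1 ordLeq_ordLess_trans by blast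
qed

text \<open>Zorn's lemma extends \<open>N\<close> to a maximal antichain. As no node can be added,
  every node is comparable with one of its members.\<close>

lemma antichain_small:
  assumes N: "antichain Tree N"
  shows "|N| <o (kappa :: 'k rel)"
proof -
  let ?\<A> = "{M. antichain Tree M \<and> N \<subseteq> M}"
  have "\<exists>M\<in>?\<A>. \<forall>X\<in>?\<A>. M \<subseteq> X \<longrightarrow> X = M"
  proof (rule subset_Zorn_nonempty)
    show "?\<A> \<noteq> {}" using N by blast
    show "\<Union>\<C> \<in> ?\<A>" if "\<C> \<noteq> {}" "subset.chain ?\<A> \<C>" for \<C>
    proof -
      have sub: "\<C> \<subseteq> ?\<A>" and chain: "\<And>X Y. X \<in> \<C> \<Longrightarrow> Y \<in> \<C> \<Longrightarrow> X \<subseteq> Y \<or> Y \<subseteq> X"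
        using that(2) unfolding subset_chain_def by blast+
      have "\<not> node_less s t \<and> \<not> node_less t s" if st: "s \<in> \<Union>\<C>" "t \<in> \<Union>\<C>" "s \<noteq> t" for s t
      proof -
        obtain X where "X \<in> \<C>" "s \<in> X" "t \<in> X" using st(1,2) chain by blast
        then show ?thesis using sub st(3) unfolding antichain_def by blast
      qed
      moreover have "\<Union>\<C> \<subseteq> Tree" using sub unfolding antichain_def by blast
      moreover have "N \<subseteq> \<Union>\<C>" using sub that(1) by blast
      ultimately show ?thesis by (simp add: antichain_def)
    qed
  qed
  then obtain M where M: "antichain Tree M" "N \<subseteq> M"
    and max: "\<And>X. antichain Tree X \<Longrightarrow> M \<subseteq> X \<Longrightarrow> X = M"
    by (smt (verit, del_insts) mem_Collect_eq subset_trans)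
  have "\<exists>a\<in>M. a \<subseteq>\<^sub>m t \<or> t \<subseteq>\<^sub>m a" if t: "t \<in> Tree" for t
  proof (rule ccontr)
    assume "\<not> ?thesis"
    then have incomp: "\<And>a. a \<in> M \<Longrightarrow> \<not> node_less a t \<and> \<not> node_less t a" and "t \<notin> M"
      unfolding node_less_def by auto
    then have "antichain Tree (insert t M)" using M(1) t unfolding antichain_def by blast
    then show False using max \<open>t \<notin> M\<close> by blast
  qed
  then have "|M| <o (kappa :: 'k rel)" by (rule maximal_antichain_small[OF M(1)])
  then show ?thesis using card_of_mono1[OF M(2)] ordLeq_ordLess_trans by blast
qed

text \<open>A \<kappa>-branch would produce an antichain of size \<kappa>: the nodes that leave the
  branch at each level.\<close>

lemma souslin_Tree: "souslin Tree"
proof -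
  have no_antichain: "\<not> |N| =o (kappa :: 'k rel)" if "antichain Tree N" for N
    using antichain_small[OF that] not_ordLess_ordIso by blast
  have "False" if B: "branch Tree UNIV B" for B
  proof -
    obtain f where "\<And>\<beta>. \<beta> \<in> UNIV \<Longrightarrow> tr \<beta> f" by (rule branch_TreeE[OF B]) auto
    then have f: "\<And>\<beta>. tr \<beta> f" by simp
    obtain v :: 'k where v: "v < omega" "v \<noteq> ozero" using ex_nonzero_less_omega by blast
    \<comment> \<open>The branch is left at \<open>\<beta>\<close> by switching to whichever of
      \<open>ozero\<close> and \<open>v\<close> ensures a change; both are below
      \<open>omega\<close>, hence admissible.\<close>
    define g where "g \<beta> = f(\<beta> := if f \<beta> = ozero then v else ozero)" for \<beta>
    define s where "s \<beta> = nd (osuc \<beta>) (g \<beta>)" for \<beta>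
    have g_less: "g \<beta> \<zeta> = f \<zeta>" if "\<zeta> < \<beta>" for \<beta> \<zeta> using that by (auto simp: g_def)
    have g_neq: "g \<beta> \<beta> \<noteq> f \<beta>" for \<beta> using v(2) by (simp add: g_def)
    have incomp: "\<not> s \<beta> \<subseteq>\<^sub>m s \<gamma> \<and> \<not> s \<gamma> \<subseteq>\<^sub>m s \<beta>" if "\<beta> < \<gamma>" for \<beta> \<gamma>
      using g_less[OF that] g_neq[of \<beta>] less_osuc[of \<beta>] less_trans[OF that less_osuc]
      unfolding s_def nd_le_iff by metis
    have incomp': "\<not> s \<beta> \<subseteq>\<^sub>m s \<gamma>" if "\<beta> \<noteq> \<gamma>" for \<beta> \<gamma>
      using incomp[of \<beta> \<gamma>] incomp[of \<gamma> \<beta>] that by (cases \<beta> \<gamma> rule: linorder_cases) auto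
    have "s \<beta> \<in> Tree" for \<beta>
      unfolding s_def g_def nd_in_Tree_iff
      by (rule tr_osuc[OF f]) (use v(1) ozero_less_omega in \<open>auto simp: less_max_iff_disj\<close>)
    then have "antichain Tree (range s)"
      using incomp' unfolding antichain_def node_less_def by (auto simp: image_subset_iff) metis+
    moreover have "inj s" using incomp' by (metis injI map_le_refl)
    then have "|range s| =o |UNIV :: 'k set|"
      using card_of_ordIsoI[of s UNIV "range s"] ordIso_symmetric by (auto simp: bij_betw_def)
    then have "|range s| =o (kappa :: 'k rel)"
      using card_UNIV_kappa[OF Card_order_kappa] ordIso_transitive by blast
    ultimately show False using no_antichain by blast
  qed
  then show ?thesis using no_antichain unfolding souslin_def by blast
qed

end

section \<open>Deriving the construction from the proxy principle\<close>

theorem theorem4p8: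
  fixes S :: "'k::wellorder set"
  assumes "strongly_inaccessible (kappa :: 'k rel)"
    and "S \<subseteq> acc UNIV"
    and "proxy_principle S"
  shows "\<exists>T :: 'k node set. streamlined_tree T \<and> normal_tree T \<and> prolific T \<and> souslin T \<and>
    V_minus T = S \<and> V T = S"
proof -
  interpret inaccessible "TYPE('k)" by unfold_locales (rule assms(1))
  obtain \<phi> :: "'k node \<Rightarrow> 'k" where \<phi>: "inj_on \<phi> (\<Union>\<beta>. bounded_nodes \<beta>)"
    using ex_node_coding by blast
  obtain A :: "'k \<Rightarrow> 'k set" where A: "diamond_sequence A"
    using assms(3) unfolding proxy_principle_def by blast
  obtain \<C> :: "'k \<Rightarrow> 'k set set" where
    \<C>_club: "\<forall>\<alpha>. \<C> \<alpha> \<noteq> {} \<and> |\<C> \<alpha>| <o (kappa :: 'k rel) \<and>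
      (\<forall>C\<in>\<C> \<alpha>. closed_subset C {..<\<alpha>} \<and> osup C = osup {..<\<alpha>})" and
    \<C>_coherent: "\<forall>\<alpha>. \<forall>C\<in>\<C> \<alpha>. \<forall>\<alpha>'\<in>acc C. \<exists>D\<in>\<C> \<alpha>'. D \<sqsubseteq>\<^bsup>S\<^esup> C" and
    \<C>_guess: "\<forall>B. cofinal B kappa \<longrightarrow> stationary {\<alpha>\<in>S. \<forall>C\<in>\<C> \<alpha>. osup (nacc C \<inter> B) = \<alpha>}"
    using conjunct2[OF assms(3)[unfolded proxy_principle_def]] by (elim exE conjE) (rule that)
  have \<C>: "closed_subset C {..<\<alpha>}" "osup C = osup {..<\<alpha>}" if "C \<in> \<C> \<alpha>" for C \<alpha>
    using \<C>_club that by blast+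
  obtain C where C: "\<And>\<alpha>. C \<alpha> \<in> \<C> \<alpha>" using \<C>_club by (meson ex_in_conv)
  have C_less: "\<zeta> < \<alpha>" if "\<zeta> \<in> C \<alpha>" for \<alpha> \<zeta>
    using \<C>(1)[OF C] that unfolding closed_subset_def by blast
  have sup_limit: "osup {..<\<alpha>} = \<alpha>" if "\<alpha> \<in> acc UNIV" for \<alpha> :: 'k
    using that by (simp add: acc_def)
  interpret tree_construction "TYPE('k)" S C A \<phi>
  proof unfold_locales
    show "S \<subseteq> acc UNIV" by (rule assms(2))
    show "\<zeta> < \<alpha>" if "\<zeta> \<in> C \<alpha>" for \<alpha> \<zeta> by (rule C_less[OF that])
    show "\<exists>\<zeta>\<in>C \<alpha>. \<xi> < \<zeta>" if "\<alpha> \<in> acc UNIV" "\<xi> < \<alpha>" for \<alpha> \<xi>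
    proof -
      have "osup (C \<alpha>) = \<alpha>" using \<C>(2)[OF C] sup_limit[OF that(1)] by metis
      then show ?thesis using that(2) osup_eq_iff[of "C \<alpha>" \<alpha> \<alpha>] C_less less_imp_le by blast
    qed
    show "\<beta> \<in> C \<alpha>"
      if "\<beta> < \<alpha>" "ozero < \<beta>" "\<And>\<xi>. \<xi> < \<beta> \<Longrightarrow> \<exists>\<zeta>\<in>C \<alpha>. \<xi> < \<zeta> \<and> \<zeta> < \<beta>" for \<alpha> \<beta>
    proof -
      have "osup (C \<alpha> \<inter> {..<\<beta>}) = \<beta>" by (subst osup_eq_iff[of _ \<beta>]) (use that(3) in auto)
      then show ?thesis using \<C>(1)[OF C, of \<alpha>] that(1,2) unfolding closed_subset_def by blast
    qed
    \<comment> \<open>Coherence gives \<open>D \<in> \<C> \<beta>\<close> with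
      \<open>osup D \<notin> S\<close>, and members of \<open>\<C> \<beta>\<close> have supremum
      \<open>\<beta>\<close> at a limit \<open>\<beta>\<close>.\<close>
    show "\<beta> \<notin> S" if \<beta>: "\<beta> \<in> acc (C \<alpha>)" for \<alpha> \<beta>
    proof -
      obtain D where D: "D \<in> \<C> \<beta>" "osup D \<notin> S"
        using \<C>_coherent C \<beta> unfolding end_extends_def by blast
      have "\<beta> \<in> acc UNIV" using \<beta> by (auto simp: acc_iff)
      then show ?thesis using D \<C>(2)[OF D(1)] sup_limit by metis
    qed
    show "inj_on \<phi> (\<Union>\<beta>. bounded_nodes \<beta>)" by (rule \<phi>)
    show "diamond_sequence A" by (rule A)
    show "\<exists>\<alpha>\<in>S. \<forall>\<xi><\<alpha>. \<exists>\<zeta>\<in>nacc (C \<alpha>) \<inter> B. \<xi> < \<zeta>" if B: "cofinal B kappa" for B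
    proof -
      \<comment> \<open>At a guessing point all members of \<open>\<C> \<alpha>\<close> behave well,
        in particular the chosen \<open>C \<alpha>\<close>.\<close>
      obtain \<alpha> where \<alpha>: "\<alpha> \<in> S" "osup (nacc (C \<alpha>) \<inter> B) = \<alpha>"
        using stationary_nonempty[OF \<C>_guess[rule_format, OF B] ex_greater] C by blast
      have "x \<le> \<alpha>" if "x \<in> nacc (C \<alpha>) \<inter> B" for x
        using that C_less[of x \<alpha>] by (auto simp: nacc_def)
      then show ?thesis using \<alpha> osup_eq_iff[of "nacc (C \<alpha>) \<inter> B" \<alpha> \<alpha>] by blast
    qed
  qed
  have "V_minus Tree = S" "V Tree = S"
    using S_subset_V V_subset_V_minus V_minus_subset_S by blast+
  then show ?thesis
    using streamlined_Tree normal_Tree prolific_Tree souslin_Tree by blast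
qed

end
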